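(* Under Assumptions 1 and 2 (as in the context), there exists a constant $C$, not depending on $n$ or on the distribution $\mathcal P\in\Xi$, such that for all $n\ge\max\{m,3\}$ and all $\mathcal P\in\Xi$, $$\mathbb E\big[\|\bm p_n^*-\bm p^*\|_2^2\big]\le \frac{C\,m\log m\,\log\log n}{n},\qquad \mathbb E\big[\|\bm p_n^*-\bm p^*\|_2\big]\le \sqrt{\frac{C\,m\log m\,\log\log n}{n}}.$$
   Context: Fix integers $m\ge1$, $n$. Consider the linear program $\max\sum_{j=1}^n r_jx_j$ subject to $\sum_{j=1}^n a_{ij}x_j\le b_i$ ($i=1,\dots,m$), $0\le x_j\le1$, with $r_j\in\mathbb R$, $\bm a_j=(a_{1j},\dots,a_{mj})^\top\in\mathbb R^m$, $b_i>0$. Let $d_i=b_i/n$, $\bm d=(d_1,\dots,d_m)^\top$. Assumption 1: (a) $(r_j,\bm a_j)$, $j=1,\dots,n$, are i.i.d. from a distribution $\mathcal P$ on $\mathbb R\times\mathbb R^m$; (b) there are constants $\bar r,\bar a>0$ with $|r_j|\le\bar r$ and $\|\bm a_j\|_2\le\bar a$; (c) there are constants $0<\underline d<\bar d$ with $d_i\in(\underline d,\bar d)$ for all $i$; write $\Omega_d=\prod_{i=1}^m(\underline d,\bar d)$; (d) $n>m$. Define $f_n(\bm p)=\bm d^\top\bm p+\frac1n\sum_{j=1}^n(r_j-\bm a_j^\top\bm p)^+$ and $f(\bm p)=\bm d^\top\bm p+\mathbb E[(r-\bm a^\top\bm p)^+]$, $(r,\bm a)\sim\mathcal P$. $\bm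 p_n^*$ is an optimal solution of $\min_{\bm p\ge0}f_n(\bm p)$ (equivalently the $\bm p$-part of an optimal solution of the dual LP $\min \bm b^\top\bm p+\sum_j y_j$ s.t. $\bm a_j^\top\bm p+y_j\ge r_j$, $\bm p,\bm y\ge0$), and $\bm p^*$ is an optimal solution of $\min_{\bm p\ge0}f(\bm p)$. Let $\Omega_p=\{\bm p\in\mathbb R^m:\bm p\ge0,\ \sum_ip_i\le\bar r/\underline d\}$. Assumption 2 (constants $\lambda_{\min},\lambda,\mu>0$): (a) $\mathbb E[\bm a\bm a^\top]$ is positive definite with minimum eigenvalue $\lambda_{\min}$; (b) for every $\bm d\in\Omega_d$, with $\bm p^*$ the minimizer of $f$ defined with that $\bm d$, for all $\bm p\in\Omega_p$: $\lambda|\bm a^\top\bm p-\bm a^\top\bm p^*|\le|\mathbb P(r>\bm a^\top\bm p\mid\bm a)-\mathbb P(r>\bm a^\top\bm p^*\mid\bm a)|\le\mu|\bm a^\top\bm p-\bm a^\top\bm p^*|$; (c) $p_i^*=0$ if and only if $d_i-\mathbb E[a_iI(r>\bm a^\top\bm p^* )]>0$. $\Xi$ denotes the family of distributions $\mathcal P$ satisfying Assumptions 1 and 2 with these fixed constants.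
   Formalization: The result is stated for m ≥ 2: for m = 1 the factor log m vanishes and the bound would force p_n* = p* almost surely, which fails e.g. for a = 1, r uniform on [0,1]. The constant C may depend on m and the other fixed constants. *)

theory Defs
  imports "HOL-Probability.Probability"
begin

text \<open>A column \<open>(r, a)\<close> of the linear program is a point of type \<open>real \<times> (real ^ 'm)\<close>; its distribution is
  a measure \<open>P\<close> on this type.\<close>

definition avg_budget :: "nat \<Rightarrow> real ^ 'm \<Rightarrow> real ^ 'm" where
  "avg_budget n b = (\<chi> i. b $ i / real n)"

definition Omega_d :: "real \<Rightarrow> real \<Rightarrow> (real ^ 'm) set" where
  "Omega_d dlo dhi = {d. \<forall>i. d $ i \<in> {dlo<..<dhi}}"

definition Omega_p :: "real \<Rightarrow> real \<Rightarrow> (real ^ 'm::finite) set" where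
  "Omega_p rbar dlo = {p. (\<forall>i. 0 \<le> p $ i) \<and> (\<Sum>i\<in>UNIV. p $ i) \<le> rbar / dlo}"

definition sample_dual :: "nat \<Rightarrow> real ^ 'm::finite \<Rightarrow> (nat \<Rightarrow> real \<times> (real ^ 'm)) \<Rightarrow> real ^ 'm \<Rightarrow> real" where
  "sample_dual n d x p =
     d \<bullet> p + (1 / real n) * (\<Sum>j=1..n. max (fst (x j) - snd (x j) \<bullet> p) 0)"

definition pop_dual :: "real ^ 'm::finite \<Rightarrow> (real \<times> (real ^ 'm)) measure \<Rightarrow> real ^ 'm \<Rightarrow> real" where
  "pop_dual d P p = d \<bullet> p + (\<integral>z. max (fst z - snd z \<bullet> p) 0 \<partial>P)"

definition sample_dual_opt :: "nat \<Rightarrow> real ^ 'm::finite \<Rightarrow> (nat \<Rightarrow> real \<times> (real ^ 'm)) \<Rightarrow> real ^ 'm \<Rightarrow> bool" where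
  "sample_dual_opt n d x = is_arg_min (sample_dual n d x) (\<lambda>p. \<forall>i. 0 \<le> p $ i)"

definition pop_dual_opt :: "real ^ 'm::finite \<Rightarrow> (real \<times> (real ^ 'm)) measure \<Rightarrow> real ^ 'm \<Rightarrow> bool" where
  "pop_dual_opt d P = is_arg_min (pop_dual d P) (\<lambda>p. \<forall>i. 0 \<le> p $ i)"

definition second_moment :: "(real \<times> (real ^ 'm)) measure \<Rightarrow> real ^ 'm ^ 'm" where
  "second_moment P = (\<chi> i j. \<integral>z. snd z $ i * snd z $ j \<partial>P)"

definition pos_definite :: "real ^ 'm ^ 'm::finite \<Rightarrow> bool" where
  "pos_definite A \<longleftrightarrow> transpose A = A \<and> (\<forall>x. x \<noteq> 0 \<longrightarrow> 0 < x \<bullet> (A *v x))"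

definition eigval :: "real ^ 'm ^ 'm::finite \<Rightarrow> real \<Rightarrow> bool" where
  "eigval A k \<longleftrightarrow> (\<exists>v. v \<noteq> 0 \<and> A *v v = k *\<^sub>R v)"

definition min_eigval :: "real ^ 'm ^ 'm::finite \<Rightarrow> real \<Rightarrow> bool" where
  "min_eigval A k \<longleftrightarrow> eigval A k \<and> (\<forall>l. eigval A l \<longrightarrow> k \<le> l)"

text \<open>The conditional probability of the event \<open>r > a \<bullet> p\<close> given \<open>a\<close>, as a function of
  \<open>z = (r, a)\<close> that is measurable with respect to the sigma-algebra generated by \<open>a\<close>. It is
  determined up to \<open>P\<close>-null sets, so statements about it are to be read almost everywhere.\<close>

definition cond_prob_accept ::
    "(real \<times> (real ^ 'm::finite)) measure \<Rightarrow> real ^ 'm \<Rightarrow> real \<times> (real ^ 'm) \<Rightarrow> real" where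
  "cond_prob_accept P p =
     real_cond_exp P (vimage_algebra (space P) snd borel) (indicator {z. fst z > snd z \<bullet> p})"

definition iid_sample ::
    "nat \<Rightarrow> 'w measure \<Rightarrow> (nat \<Rightarrow> 'w \<Rightarrow> real \<times> (real ^ 'm::finite)) \<Rightarrow> (real \<times> (real ^ 'm)) measure \<Rightarrow> bool" where
  "iid_sample n M X P \<longleftrightarrow>
     prob_space M \<and> prob_space.indep_vars M (\<lambda>_. borel) X {1..n} \<and>
     (\<forall>j\<in>{1..n}. distr M borel (X j) = P)"

definition bounded_columns :: "real \<Rightarrow> real \<Rightarrow> (real \<times> (real ^ 'm::finite)) measure \<Rightarrow> bool" where
  "bounded_columns rbar abar P \<longleftrightarrow> (AE z in P. \<bar>fst z\<bar> \<le> rbar \<and> norm (snd z) \<le> abar)"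

text \<open>The Lipschitz-type bounds on the conditional probability are required for the minimizers of
  all right-hand sides in \<open>Omega_d\<close>, not only for the right-hand side of the given program.\<close>

definition cond_prob_bounds ::
    "real \<Rightarrow> real \<Rightarrow> real \<Rightarrow> real \<Rightarrow> real \<Rightarrow> (real \<times> (real ^ 'm::finite)) measure \<Rightarrow> bool" where
  "cond_prob_bounds rbar dlo dhi lam mu P \<longleftrightarrow>
     (\<forall>d\<in>Omega_d dlo dhi. \<forall>q. pop_dual_opt d P q \<longrightarrow>
       (\<forall>p\<in>Omega_p rbar dlo. AE z in P.
          lam * \<bar>snd z \<bullet> p - snd z \<bullet> q\<bar> \<le> \<bar>cond_prob_accept P p z - cond_prob_accept P q z\<bar> \<and>
          \<bar>cond_prob_accept P p z - cond_prob_accept P q z\<bar> \<le> mu * \<bar>snd z \<bullet> p - snd z \<bullet> q\<bar>))"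

definition strict_complementarity ::
    "real ^ 'm::finite \<Rightarrow> (real \<times> (real ^ 'm)) measure \<Rightarrow> bool" where
  "strict_complementarity d P \<longleftrightarrow>
     (\<forall>q. pop_dual_opt d P q \<longrightarrow>
       (\<forall>i. q $ i = 0 \<longleftrightarrow>
          0 < d $ i - (\<integral>z. snd z $ i * indicator {z. fst z > snd z \<bullet> q} z \<partial>P)))"

text \<open>The family of admissible distributions. It depends on \<open>d\<close> through the complementarity
  condition only.\<close>

definition Xi ::
    "real \<Rightarrow> real \<Rightarrow> real \<Rightarrow> real \<Rightarrow> real \<Rightarrow> real \<Rightarrow> real \<Rightarrow> real ^ 'm::finite
      \<Rightarrow> (real \<times> (real ^ 'm)) measure set" where
  "Xi rbar abar dlo dhi lmin lam mu d =
     {P. prob_space P \<and> sets P = sets borel \<and> bounded_columns rbar abar P \<and>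
         pos_definite (second_moment P) \<and> min_eigval (second_moment P) lmin \<and>
         cond_prob_bounds rbar dlo dhi lam mu P \<and> strict_complementarity d P}"

end

theory Submission
  imports Defs
begin

text \<open>Write \<open>q\<close> for the minimizer of \<open>f\<close> and \<open>D = p - q\<close>. Linearizing the positive part at \<open>q\<close> gives
  \<open>f\<^sub>n p - f\<^sub>n q = g\<^sub>n \<bullet> D + H\<^sub>n D\<close>, where \<open>g\<^sub>n\<close> is a subgradient at \<open>q\<close> and \<open>H\<^sub>n D\<close> is an average of i.i.d.
  terms in \<open>[0, \<bar>a \<bullet> D\<bar>]\<close> whose mean is at least \<open>\<kappa> (norm D)\<^sup>2\<close> by Assumption 2. A Chernoff bound makes
  \<open>H\<^sub>n D \<le> \<kappa> (norm D)\<^sup>2 / 4\<close> have probability at most \<open>exp (- c n (norm D))\<close>, hence at most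
  \<open>exp (- c sqrt n)\<close> when \<open>norm D \<ge> 1 / sqrt n\<close>. A union bound over a grid with \<open>O(n\<^sup>m)\<close> points shows that
  \<open>H\<^sub>n\<close> grows quadratically, uniformly in such \<open>D\<close>, outside an event of probability \<open>O(1 / n)\<close>. There the
  optimality of \<open>p\<^sub>n\<close> for \<open>f\<^sub>n\<close> and of \<open>q\<close> for \<open>f\<close> bound \<open>norm (p\<^sub>n - q)\<close> by a multiple of
  \<open>norm (g\<^sub>n - g) + 1 / sqrt n\<close>, whose second moment is \<open>O(1 / n)\<close>. As the dimension is a type, the constant
  may depend on it, so this rate is stronger than the claimed one.\<close>

section \<open>Covering numbers, eigenvalues and tail bounds\<close>

text \<open>Points in the same cell of side \<open>e\<close> differ by at most \<open>e\<close> in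
  each coordinate, and bounding the norm by the sum of coordinates gives the factor
  \<open>CARD('m)\<close>. The net lies inside \<open>S\<close> because the tail bound to be summed
  over it holds only for feasible displacements.\<close>

lemma grid_cover:
  fixes S :: "(real ^ 'm::finite) set"
  assumes S: "\<And>x i. x \<in> S \<Longrightarrow> \<bar>x $ i\<bar> \<le> R" and e: "0 < e" and R: "0 \<le> R"
  obtains F where "finite F" "F \<subseteq> S" "real (card F) \<le> (2 * R / e + 2) ^ CARD('m)"
    "\<And>x. x \<in> S \<Longrightarrow> \<exists>y\<in>F. norm (x - y) \<le> real CARD('m) * e"
proof -
  define g :: "real ^ 'm \<Rightarrow> 'm \<Rightarrow> int" where "g x = (\<lambda>i. \<lfloor>x $ i / e\<rfloor>)" for x
  define I where "I = {\<lfloor>- R / e\<rfloor> .. \<lfloor>R / e\<rfloor>}"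
  have gI: "g ` S \<subseteq> PiE UNIV (\<lambda>_. I)"
  proof -
    have "g x i \<in> I" if "x \<in> S" for x i
    proof -
      from S[OF that, of i] have "- R \<le> x $ i" "x $ i \<le> R" by auto
      then have "\<lfloor>- R / e\<rfloor> \<le> \<lfloor>x $ i / e\<rfloor>" "\<lfloor>x $ i / e\<rfloor> \<le> \<lfloor>R / e\<rfloor>"
        using e by (intro floor_mono divide_right_mono; simp)+
      then show ?thesis by (simp add: g_def I_def)
    qed
    then show ?thesis by auto
  qed
  have fin: "finite (PiE (UNIV :: 'm set) (\<lambda>_. I))"
    by (rule finite_PiE) (auto simp: I_def)
  have cI: "real (card I) \<le> 2 * R / e + 2"
  proof -
    have "0 \<le> R / e" using R e by simp
    then have "\<lfloor>- R / e\<rfloor> \<le> \<lfloor>R / e\<rfloor>" by (intro floor_mono) auto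
    then have "real (card I) = of_int \<lfloor>R / e\<rfloor> - of_int \<lfloor>- R / e\<rfloor> + 1"
      by (simp add: I_def)
    also have "\<dots> \<le> 2 * R / e + 2"
      by linarith
    finally show ?thesis .
  qed
  \<comment> \<open>One representative from \<open>S\<close> is taken in every occupied cell; cell
    corners might fall outside \<open>S\<close>.\<close>
  define F where "F = inv_into S g ` (g ` S)"
  show thesis
  proof
    have fg: "finite (g ` S)" using gI fin by (rule finite_subset)
    then show "finite F" by (simp add: F_def)
    show "F \<subseteq> S" by (auto simp: F_def inv_into_into)
    have "card F \<le> card (g ` S)" using fg by (simp add: F_def card_image_le)
    also have "\<dots> \<le> card (PiE (UNIV :: 'm set) (\<lambda>_. I))" by (rule card_mono[OF fin gI])
    also have "\<dots> = card I ^ CARD('m)" by (simp add: card_PiE)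
    finally have "real (card F) \<le> real (card I) ^ CARD('m)"
      by (metis of_nat_le_iff of_nat_power)
    also have "\<dots> \<le> (2 * R / e + 2) ^ CARD('m)" using cI by (intro power_mono) auto
    finally show "real (card F) \<le> (2 * R / e + 2) ^ CARD('m)" .
    fix x assume x: "x \<in> S"
    define y where "y = inv_into S g (g x)"
    have "y \<in> F" using x by (auto simp: F_def y_def)
    have gy: "g y = g x" using x by (simp add: y_def f_inv_into_f)
    have "\<bar>(x - y) $ i\<bar> \<le> e" for i
    proof -
      have "\<lfloor>y $ i / e\<rfloor> = \<lfloor>x $ i / e\<rfloor>" using gy by (simp add: g_def fun_eq_iff)
      then have "\<bar>x $ i / e - y $ i / e\<bar> \<le> 1" by linarith
      then show ?thesis using e by (simp add: field_simps abs_if split: if_splits)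
    qed
    then have "norm (x - y) \<le> (\<Sum>i\<in>(UNIV :: 'm set). e)"
      by (intro order_trans[OF norm_le_l1_cart] sum_mono)
    then show "\<exists>y\<in>F. norm (x - y) \<le> real CARD('m) * e" using \<open>y \<in> F\<close> by auto
  qed
qed

section \<open>The smallest eigenvalue as a bound on the quadratic form\<close>

text \<open>The form of \<open>A - k I\<close> is nonnegative and vanishes at \<open>v\<close>, so
  its first variation at \<open>v\<close> vanishes. In the direction \<open>w = A v - k v\<close>
  that variation is \<open>2 (w \<bullet> w)\<close>, which forces \<open>w = 0\<close>.\<close>

lemma quadratic_form_eigenvector:
  fixes A :: "real ^ 'm ^ 'm::finite"
  assumes sym: "transpose A = A"
    and ge: "\<And>x. k * (x \<bullet> x) \<le> x \<bullet> (A *v x)" and v: "v \<bullet> (A *v v) = k * (v \<bullet> v)"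
  shows "A *v v = k *\<^sub>R v"
proof -
  define w where "w = A *v v - k *\<^sub>R v"
  have comm: "w \<bullet> (A *v v) = v \<bullet> (A *v w)"
    by (metis sym dot_lmul_matrix inner_commute transpose_matrix_vector)
  have ineq: "0 \<le> 2 * t * (w \<bullet> w) + t\<^sup>2 * (w \<bullet> (A *v w) - k * (w \<bullet> w))" for t
  proof -
    have "0 \<le> (v + t *\<^sub>R w) \<bullet> (A *v (v + t *\<^sub>R w)) - k * ((v + t *\<^sub>R w) \<bullet> (v + t *\<^sub>R w))"
      using ge[of "v + t *\<^sub>R w"] by simp
    also have "\<dots> = 2 * t * (w \<bullet> (A *v v) - k * (w \<bullet> v)) + t\<^sup>2 * (w \<bullet> (A *v w) - k * (w \<bullet> w))"
      using v comm
      by (simp add: matrix_vector_right_distrib matrix_vector_mult_scaleR inner_add_left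
          inner_add_right algebra_simps power2_eq_square inner_commute[of v w])
    also have "w \<bullet> (A *v v) - k * (w \<bullet> v) = w \<bullet> w"
      unfolding w_def by (simp add: inner_diff_right)
    finally show ?thesis .
  qed
  define c where "c = w \<bullet> (A *v w) - k * (w \<bullet> w)"
  have c0: "0 \<le> c" using ge[of w] by (simp add: c_def)
  have "w \<bullet> w \<le> 0"
  proof (rule ccontr)
    assume "\<not> w \<bullet> w \<le> 0"
    then have pos: "0 < w \<bullet> w" by linarith
    \<comment> \<open>A negative step short enough for the linear term to dominate the quadratic
      one; \<open>c + 1\<close> keeps the quotient meaningful when \<open>c = 0\<close>.\<close>
    define t where "t = - (w \<bullet> w) / (c + 1)"
    have "t * c = - (w \<bullet> w) + (w \<bullet> w) / (c + 1)" using c0 by (simp add: t_def field_simps)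
    moreover have "(w \<bullet> w) / (c + 1) \<le> w \<bullet> w" using c0 pos by (simp add: field_simps)
    ultimately have "0 < 2 * (w \<bullet> w) + t * c" using pos c0
      by (smt (verit) divide_pos_pos)
    moreover have "t < 0" using pos c0 by (simp add: t_def)
    ultimately have "t * (2 * (w \<bullet> w) + t * c) < 0" by (simp add: mult_neg_pos)
    with ineq[of t] show False by (simp add: c_def algebra_simps power2_eq_square)
  qed
  then have "w = 0" by (metis inner_eq_zero_iff inner_ge_zero order_antisym)
  then show ?thesis by (simp add: w_def)
qed

text \<open>By compactness the form attains its minimum on the unit sphere. The minimizer is an
  eigenvector by the preceding lemma, so the minimum is an eigenvalue and at least \<open>k\<close>;
  homogeneity extends the bound to all \<open>x\<close>.\<close>

lemma min_eigval_le_quadratic_form: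
  fixes A :: "real ^ 'm ^ 'm::finite"
  assumes sym: "transpose A = A" and k: "min_eigval A k"
  shows "k * (x \<bullet> x) \<le> x \<bullet> (A *v x)"
proof -
  have "continuous_on (sphere 0 1) (\<lambda>x. x \<bullet> (A *v x))"
    by (intro continuous_intros matrix_vector_mult_linear_continuous_on)
  moreover have "sphere (0 :: real ^ 'm) 1 \<noteq> {}"
    by (simp)
  ultimately obtain v where v: "norm v = 1" "\<And>x. norm x = 1 \<Longrightarrow> v \<bullet> (A *v v) \<le> x \<bullet> (A *v x)"
    using continuous_attains_inf[of "sphere 0 1" "\<lambda>x. x \<bullet> (A *v x)"] by auto
  define l where "l = v \<bullet> (A *v v)"
  have ge: "l * (x \<bullet> x) \<le> x \<bullet> (A *v x)" for x
  proof (cases "x = 0")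
    case False
    have "l \<le> (x /\<^sub>R norm x) \<bullet> (A *v (x /\<^sub>R norm x))"
      unfolding l_def using False by (intro v(2)) simp
    also have "\<dots> = (x \<bullet> (A *v x)) / (x \<bullet> x)"
      by (simp add: matrix_vector_mult_scaleR divide_inverse power2_norm_eq_inner[symmetric]
          power2_eq_square)
    finally show ?thesis using False by (simp add: field_simps)
  qed simp
  have vv: "v \<bullet> v = 1" using v(1) by (simp add: norm_eq_1)
  have "A *v v = l *\<^sub>R v"
    by (rule quadratic_form_eigenvector[OF sym ge]) (simp add: l_def vv)
  then have "eigval A l" using v(1) unfolding eigval_def by (intro exI[of _ v]) auto
  then have "k \<le> l" using k by (simp add: min_eigval_def)
  then have "k * (x \<bullet> x) \<le> l * (x \<bullet> x)" by (simp add: mult_right_mono)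
  then show ?thesis using ge[of x] by simp
qed

section \<open>Concentration of independent sums\<close>

text \<open>By convexity the exponential lies below its chord over the interval from -1 to 0, and
  \<open>exp (-1)\<close> is at most 1/2.\<close>

lemma exp_minus_le_affine:
  fixes x :: real
  assumes "0 \<le> x" "x \<le> 1"
  shows "exp (- x) \<le> 1 - x / 2"
proof -
  have "exp ((1 - x) *\<^sub>R 0 + x *\<^sub>R (-1)) \<le> (1 - x) * exp 0 + x * exp (-1 :: real)"
    using assms by (intro convex_onD[OF exp_convex]) auto
  moreover have "exp (-1 :: real) \<le> 1 / 2"
    using exp_ge_add_one_self[of 1] by (simp add: exp_minus field_simps)
  then have "x * exp (-1) \<le> x * (1 / 2)" using assms by (intro mult_left_mono)
  ultimately show ?thesis by simp
qed

text \<open>Chernoff's method with parameter \<open>1 / B\<close>. Nonnegativity makes the exponent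
  linear in \<open>u / B\<close>, where a Hoeffding bound would give its square; this matters when
  \<open>u\<close> is of order \<open>B\<^sup>2\<close> and \<open>B\<close> is small.\<close>

lemma (in prob_space) lower_tail_nonneg_sum:
  fixes Y :: "'i \<Rightarrow> 'a \<Rightarrow> real"
  assumes I: "finite I" and ind: "indep_vars (\<lambda>_. borel) Y I"
    and Y: "\<And>j. j \<in> I \<Longrightarrow> AE w in M. 0 \<le> Y j w \<and> Y j w \<le> B"
    and mean: "\<And>j. j \<in> I \<Longrightarrow> u \<le> expectation (Y j)" and B: "0 < B"
  shows "prob {w \<in> space M. (\<Sum>j\<in>I. Y j w) \<le> real (card I) * u / 4}
    \<le> exp (- (real (card I) * u / (4 * B)))"
proof -
  have [measurable]: "Y j \<in> borel_measurable M" if "j \<in> I" for j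
    using ind that by (auto simp: indep_vars_def)
  define Z where "Z = (\<lambda>j w. exp (- (Y j w / B)))"
  have Zm: "Z j \<in> borel_measurable M" if "j \<in> I" for j
    using that unfolding Z_def by measurable
  have indZ: "indep_vars (\<lambda>_. borel) Z I"
    unfolding Z_def by (rule indep_vars_compose2[OF ind]) measurable
  have Yint: "integrable M (Y j)" if "j \<in> I" for j
    using Y[OF that] that by (intro integrable_const_bound[of _ B]) auto
  have Zint: "integrable M (Z j)" if "j \<in> I" for j
    using Y[OF that] B Zm[OF that]
    by (intro integrable_const_bound[of _ 1]) (auto simp: Z_def elim!: eventually_mono)
  have EZ: "expectation (Z j) \<le> exp (- (u / (2 * B)))" if j: "j \<in> I" for j
  proof -
    have "expectation (Z j) \<le> expectation (\<lambda>w. 1 - Y j w / B / 2)"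
    proof (rule integral_mono_AE)
      show "AE w in M. Z j w \<le> 1 - Y j w / B / 2"
        using Y[OF j]
      proof eventually_elim
        case (elim w)
        then show ?case unfolding Z_def using B by (intro exp_minus_le_affine) auto
      qed
    qed (use Zint Yint j in auto)
    also have "\<dots> = 1 - expectation (Y j) / (2 * B)"
      using Yint[OF j] by (simp add: prob_space)
    also have "\<dots> \<le> 1 - u / (2 * B)" using mean[OF j] B by (simp add: field_simps)
    also have "\<dots> \<le> exp (- (u / (2 * B)))" using exp_ge_add_one_self[of "- (u / (2 * B))"] by simp
    finally show ?thesis .
  qed
  \<comment> \<open>The image of the threshold under \<open>exp (- x / B)\<close>. Each factor has
    mean at most \<open>exp (- u / (2 * B))\<close>, so dividing by \<open>c\<close> in Markov's
    inequality uses up half of the exponent.\<close>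
  define c where "c = exp (- (real (card I) * u / (4 * B)))"
  have "{w \<in> space M. (\<Sum>j\<in>I. Y j w) \<le> real (card I) * u / 4}
      = {w \<in> space M. c \<le> (\<Prod>j\<in>I. Z j w)}"
    using B I by (auto simp: c_def Z_def exp_sum[symmetric] sum_negf sum_divide_distrib[symmetric] field_simps)
  then have "prob {w \<in> space M. (\<Sum>j\<in>I. Y j w) \<le> real (card I) * u / 4}
      = prob {w \<in> space M. c \<le> (\<Prod>j\<in>I. Z j w)}" by simp
  also have "\<dots> \<le> expectation (\<lambda>w. \<Prod>j\<in>I. Z j w) / c"
    using indep_vars_integrable[OF I indZ] Zint
    by (intro integral_Markov_inequality_measure[of _ _ "{}"]) (auto simp: c_def Z_def prod_nonneg)
  also have "expectation (\<lambda>w. \<Prod>j\<in>I. Z j w) = (\<Prod>j\<in>I. expectation (Z j))"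
    using Zint by (intro indep_vars_lebesgue_integral[OF I indZ]) auto
  also have "(\<Prod>j\<in>I. expectation (Z j)) / c \<le> (\<Prod>j\<in>I. exp (- (u / (2 * B)))) / c"
    using EZ by (intro divide_right_mono prod_mono) (auto simp: c_def Z_def)
  also have "\<dots> = exp (- (real (card I) * u / (4 * B)))"
    by (simp add: c_def exp_of_nat_mult[symmetric] exp_diff[symmetric] field_simps)
  finally show ?thesis .
qed

text \<open>Each new term is independent of the sum of the others and centered, so the cross term
  has mean zero. Integrability is part of the claim so that the induction can carry it.\<close>

lemma (in prob_space) second_moment_centered_sum:
  fixes Z :: "'i \<Rightarrow> 'a \<Rightarrow> real"
  assumes I: "finite I" and ind: "indep_vars (\<lambda>_. borel) Z I"
    and Z: "\<And>j. j \<in> I \<Longrightarrow> AE w in M. \<bar>Z j w\<bar> \<le> B"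
    and mean: "\<And>j. j \<in> I \<Longrightarrow> expectation (Z j) = 0"
  shows "integrable M (\<lambda>w. (\<Sum>j\<in>I. Z j w)\<^sup>2) \<and>
    expectation (\<lambda>w. (\<Sum>j\<in>I. Z j w)\<^sup>2) \<le> real (card I) * B\<^sup>2"
  using I ind Z mean
proof (induction I rule: finite_induct)
  case empty
  then show ?case by simp
next
  case (insert i I)
  have ZI: "Z j \<in> borel_measurable M" "integrable M (Z j)" if "j \<in> insert i I" for j
  proof -
    show m: "Z j \<in> borel_measurable M"
      using insert.prems(1) that by (auto simp: indep_vars_def)
    show "integrable M (Z j)"
      using insert.prems(2)[OF that] m by (intro integrable_const_bound[of _ B]) auto
  qed
  have "indep_vars (\<lambda>_. borel) Z I"
    using insert.prems(1) by (rule indep_vars_subset) auto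
  then have IH: "integrable M (\<lambda>w. (\<Sum>j\<in>I. Z j w)\<^sup>2)"
    "expectation (\<lambda>w. (\<Sum>j\<in>I. Z j w)\<^sup>2) \<le> real (card I) * B\<^sup>2"
    using insert.IH insert.prems by auto
  have sq: "integrable M (\<lambda>w. (Z i w)\<^sup>2)" "expectation (\<lambda>w. (Z i w)\<^sup>2) \<le> B\<^sup>2"
  proof -
    have ae: "AE w in M. (Z i w)\<^sup>2 \<le> B\<^sup>2"
      using insert.prems(2)[of i] by (auto elim!: eventually_mono intro: power2_le_iff_abs_le[THEN iffD2] dest: order_trans[OF abs_ge_zero])
    show i: "integrable M (\<lambda>w. (Z i w)\<^sup>2)"
      using ae ZI(1)[of i] by (intro integrable_const_bound[of _ "B\<^sup>2"]) auto
    have "expectation (\<lambda>w. (Z i w)\<^sup>2) \<le> expectation (\<lambda>_. B\<^sup>2)"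
      using ae i by (intro integral_mono_AE) auto
    then show "expectation (\<lambda>w. (Z i w)\<^sup>2) \<le> B\<^sup>2" by (simp add: prob_space)
  qed
  have iv: "indep_var borel (Z i) borel (\<lambda>w. \<Sum>j\<in>I. Z j w)"
    using insert by (intro indep_vars_sum) auto
  have iS: "integrable M (\<lambda>w. \<Sum>j\<in>I. Z j w)" using ZI by auto
  have cross: "integrable M (\<lambda>w. Z i w * (\<Sum>j\<in>I. Z j w))"
    "expectation (\<lambda>w. Z i w * (\<Sum>j\<in>I. Z j w)) = 0"
    using indep_var_integrable[OF iv _ iS] indep_var_lebesgue_integral[OF iv _ iS] ZI(2)[of i]
      insert.prems(3)[of i] by auto
  have eq: "(\<lambda>w. (\<Sum>j\<in>insert i I. Z j w)\<^sup>2)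
      = (\<lambda>w. (Z i w)\<^sup>2 + 2 * (Z i w * (\<Sum>j\<in>I. Z j w)) + (\<Sum>j\<in>I. Z j w)\<^sup>2)"
    using insert.hyps by (simp add: fun_eq_iff power2_sum algebra_simps)
  have "expectation (\<lambda>w. (\<Sum>j\<in>insert i I. Z j w)\<^sup>2)
      = expectation (\<lambda>w. (Z i w)\<^sup>2) + 2 * 0 + expectation (\<lambda>w. (\<Sum>j\<in>I. Z j w)\<^sup>2)"
    unfolding eq cross(2)[symmetric] using sq cross(1) IH by simp
  also have "\<dots> \<le> real (card (insert i I)) * B\<^sup>2"
    using sq(2) IH(2) insert.hyps by (simp add: algebra_simps)
  finally show ?case unfolding eq using sq cross IH by auto
qed

section \<open>Exponential decay against polynomial growth\<close>

text \<open>A single term of the exponential series is at most the whole series.\<close>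

lemma power_le_fact_exp:
  fixes x :: real
  assumes "0 \<le> x"
  shows "x ^ k \<le> fact k * exp x"
proof -
  have "(\<Sum>i\<in>{k}. x ^ i /\<^sub>R fact i) \<le> (\<Sum>i. x ^ i /\<^sub>R fact i)"
    using assms sums_summable[OF exp_converges[of x]] by (intro sum_le_suminf) auto
  then have "x ^ k /\<^sub>R fact k \<le> exp x" unfolding sums_unique[OF exp_converges[of x], symmetric] by simp
  then show ?thesis by (simp add: field_simps)
qed

text \<open>The exponent \<open>2 * (k + 1)\<close> turns \<open>sqrt n\<close> into
  \<open>n ^ (k + 1)\<close>: it cancels \<open>n ^ k\<close> and leaves one factor
  \<open>1 / n\<close>.\<close>

lemma power_exp_sqrt_le:
  fixes c :: real
  assumes c: "0 < c" and n: "0 < n"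
  shows "real n ^ k * exp (- (c * sqrt (real n))) \<le> fact (2 * (k + 1)) / c ^ (2 * (k + 1)) / real n"
proof -
  have "(c * sqrt (real n)) ^ (2 * (k + 1)) \<le> fact (2 * (k + 1)) * exp (c * sqrt (real n))"
    using c by (intro power_le_fact_exp) auto
  also have "(c * sqrt (real n)) ^ (2 * (k + 1)) = c ^ (2 * (k + 1)) * real n ^ (k + 1)"
    unfolding power_mult_distrib power_mult by simp
  finally show ?thesis
    using c n by (simp add: exp_minus field_simps)
qed

section \<open>The remainder of the linearized positive part\<close>

text \<open>This is the integral over \<open>u\<close> from 0 to \<open>t\<close> of the indicator
  of \<open>s > 0\<close> minus the indicator of \<open>s > u\<close>. At \<open>s = 0\<close> the
  subgradient 0 is chosen, in agreement with the strict acceptance rule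
  \<open>r > a \<bullet> p\<close>.\<close>

definition kink :: "real \<Rightarrow> real \<Rightarrow> real" where
  "kink s t = max (s - t) 0 - max s 0 + (if 0 < s then t else 0)"

text \<open>Nonnegativity is the subgradient inequality. The Lipschitz constant 2 collects 1 from
  the positive part and 1 from the linear term.\<close>

lemma kink_bounds:
  "0 \<le> kink s t" "kink s t \<le> \<bar>t\<bar>" "\<bar>kink s t - kink s t'\<bar> \<le> 2 * \<bar>t - t'\<bar>"
  by (auto simp: kink_def max_def abs_if)

text \<open>In the integral representation the absolute value of the integrand grows with the
  distance from 0. Keeping only the half beyond \<open>t / 2\<close> and the integrand's value at
  \<open>t / 2\<close> gives this bound; the value at \<open>t\<close> on the whole range gives the
  upper bound that follows.\<close>

lemma kink_lower: "- (t / 2) * (indicator {0<..} (s - t / 2) - indicator {0<..} s) \<le> kink s t"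
  by (auto simp: kink_def max_def indicator_def)

lemma kink_upper: "kink s t \<le> - t * (indicator {0<..} (s - t) - indicator {0<..} s)"
  by (auto simp: kink_def max_def indicator_def)

lemma minus_mult_indicator_diff_nonneg:
  "0 \<le> - t * (indicator {0<..} (s - t) - indicator {0<..} s :: real)"
  by (auto simp: indicator_def)

section \<open>Quadratic growth of the population dual\<close>

locale dual_problem = prob_space P
  for P :: "(real \<times> (real ^ 'm::finite)) measure" +
  fixes rbar abar dlo dhi lmin lam mu :: real and d q :: "real ^ 'm"
  assumes rbar: "0 < rbar" and abar: "0 < abar" and dlo: "0 < dlo"
    and lmin: "0 < lmin" and lam: "0 < lam" and mu: "0 < mu"
    and d: "d \<in> Omega_d dlo dhi"
    and P_in_Xi: "P \<in> Xi rbar abar dlo dhi lmin lam mu d"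
    and q_opt: "pop_dual_opt d P q"
begin

section \<open>Integrability and the bounded set of dual prices\<close>

lemma sets_P [measurable_cong]: "sets P = sets borel"
  using P_in_Xi by (simp add: Xi_def)

lemma space_P [simp]: "space P = UNIV"
  using sets_eq_imp_space_eq[OF sets_P] by simp

lemma prob_UNIV [simp]: "prob UNIV = 1"
  using prob_space by simp

lemma columns_bounded: "AE z in P. \<bar>fst z\<bar> \<le> rbar \<and> norm (snd z) \<le> abar"
  using P_in_Xi by (simp add: Xi_def bounded_columns_def)

lemma inner_bounded: "AE z in P. \<bar>snd z \<bullet> D\<bar> \<le> abar * norm D"
  using columns_bounded
proof eventually_elim
  case (elim z)
  have "\<bar>snd z \<bullet> D\<bar> \<le> norm (snd z) * norm D" by (rule Cauchy_Schwarz_ineq2)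
  also have "\<dots> \<le> abar * norm D" using elim by (intro mult_right_mono) auto
  finally show ?case .
qed

lemma fst_measurable [measurable]: "(fst :: real \<times> (real ^ 'm) \<Rightarrow> real) \<in> borel_measurable borel"
  by (intro borel_measurable_continuous_onI continuous_intros)

lemma snd_measurable [measurable]: "(snd :: real \<times> (real ^ 'm) \<Rightarrow> real ^ 'm) \<in> borel_measurable borel"
  by (intro borel_measurable_continuous_onI continuous_intros)

lemma component_measurable [measurable]:
  "(\<lambda>z :: real \<times> (real ^ 'm). snd z $ i) \<in> borel_measurable borel"
  by (intro borel_measurable_continuous_onI continuous_intros)

lemma inner_integrable: "integrable P (\<lambda>z. snd z \<bullet> D)"
  using inner_bounded by (intro integrable_const_bound[of _ "abar * norm D"]) auto

lemma inner_square_integrable: "integrable P (\<lambda>z. (snd z \<bullet> D)\<^sup>2)"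
proof (rule integrable_const_bound[of _ "(abar * norm D)\<^sup>2"])
  show "AE z in P. norm ((snd z \<bullet> D)\<^sup>2) \<le> (abar * norm D)\<^sup>2"
    using inner_bounded[of D]
  proof eventually_elim
    case (elim z)
    then have "\<bar>snd z \<bullet> D\<bar>\<^sup>2 \<le> (abar * norm D)\<^sup>2" by (intro power_mono) auto
    then show ?case by simp
  qed
qed measurable

definition accept :: "real ^ 'm \<Rightarrow> real \<times> (real ^ 'm) \<Rightarrow> real" where
  "accept p = indicator {z. fst z > snd z \<bullet> p}"

lemma accept_measurable [measurable]: "accept p \<in> borel_measurable borel"
  unfolding accept_def by measurable

lemma accept_range: "0 \<le> accept p z" "accept p z \<le> 1"
  by (auto simp: accept_def indicator_def)

lemma accept_integrable: "integrable P (accept p)"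
  using accept_range by (intro integrable_const_bound[of _ 1]) auto

lemma inner_accept_integrable: "integrable P (\<lambda>z. (snd z \<bullet> D) * accept p z)"
proof (rule Bochner_Integration.integrable_bound[OF inner_integrable[of D]])
  show "AE z in P. norm (snd z \<bullet> D * accept p z) \<le> norm (snd z \<bullet> D)"
    using accept_range[of p] by (auto simp: abs_mult mult_left_le)
qed measurable

text \<open>Every component of \<open>d\<close> exceeds \<open>dlo\<close>, so
  \<open>d \<bullet> p\<close> dominates \<open>dlo\<close> times the coordinate sum. This places
  the population and the sample optimum in the set where the conditional probability bounds
  apply.\<close>

lemma Omega_pI:
  assumes "\<And>i. 0 \<le> p $ i" and "d \<bullet> p \<le> rbar"
  shows "p \<in> Omega_p rbar dlo"
proof -
  have "dlo * (\<Sum>i\<in>UNIV. p $ i) \<le> d \<bullet> p"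
    unfolding sum_distrib_left inner_vec_def inner_real_def
    using d assms(1) by (intro sum_mono mult_right_mono) (auto simp: Omega_d_def less_imp_le)
  then have "dlo * (\<Sum>i\<in>UNIV. p $ i) \<le> rbar" using assms(2) by simp
  then show ?thesis using assms(1) dlo by (simp add: Omega_p_def field_simps)
qed

lemma Omega_p_segment:
  assumes "p \<in> Omega_p rbar dlo" "p' \<in> Omega_p rbar dlo" "0 \<le> t" "t \<le> 1"
  shows "p + t *\<^sub>R (p' - p) \<in> Omega_p rbar dlo"
proof -
  have eq: "(p + t *\<^sub>R (p' - p)) $ i = (1 - t) * p $ i + t * p' $ i" for i
    by (simp add: algebra_simps)
  have "(\<Sum>i\<in>UNIV. (1 - t) * p $ i + t * p' $ i) \<le> (1 - t) * (rbar / dlo) + t * (rbar / dlo)"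
    unfolding sum.distrib sum_distrib_left[symmetric]
    using assms by (intro add_mono mult_left_mono) (auto simp: Omega_p_def)
  also have "\<dots> = rbar / dlo" by (metis add.commute diff_add_cancel distrib_right mult_1)
  finally show ?thesis using assms unfolding Omega_p_def eq mem_Collect_eq by simp
qed

lemma Omega_p_diff_bounded:
  fixes p p' :: "real ^ 'm"
  assumes "p \<in> Omega_p rbar dlo" "p' \<in> Omega_p rbar dlo"
  shows "\<bar>(p - p') $ i\<bar> \<le> rbar / dlo" "norm (p - p') \<le> real CARD('m) * (rbar / dlo)"
proof -
  have le: "0 \<le> p $ i" "p $ i \<le> rbar / dlo" if "p \<in> Omega_p rbar dlo" for p i
  proof -
    show "0 \<le> p $ i" using that by (simp add: Omega_p_def)
    have "p $ i \<le> (\<Sum>i\<in>UNIV. p $ i)"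
      using that by (intro member_le_sum) (auto simp: Omega_p_def)
    then show "p $ i \<le> rbar / dlo" using that by (simp add: Omega_p_def)
  qed
  show *: "\<bar>(p - p') $ i\<bar> \<le> rbar / dlo" for i
    using le[OF assms(1), of i] le[OF assms(2), of i] by simp
  show "norm (p - p') \<le> real CARD('m) * (rbar / dlo)"
    using sum_mono[of UNIV "\<lambda>i. \<bar>(p - p') $ i\<bar>" "\<lambda>_ :: 'm. rbar / dlo"] *
    by (intro order_trans[OF norm_le_l1_cart]) auto
qed

lemma loss_integrable: "integrable P (\<lambda>z. max (fst z - snd z \<bullet> p) 0)"
proof (rule integrable_const_bound[of _ "rbar + abar * norm p"])
  show "AE z in P. norm (max (fst z - snd z \<bullet> p) 0) \<le> rbar + abar * norm p"
    using inner_bounded[of p] columns_bounded by eventually_elim (auto simp: max_def)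
qed measurable

lemma q_nonneg: "0 \<le> q $ i"
  using q_opt by (simp add: pop_dual_opt_def is_arg_min_linorder)

lemma pop_dual_min:
  assumes "\<And>i. 0 \<le> p $ i"
  shows "pop_dual d P q \<le> pop_dual d P p"
  using q_opt assms by (auto simp: pop_dual_opt_def is_arg_min_linorder)

text \<open>Comparison with the feasible point 0, where the objective is the mean of the positive
  part of \<open>r\<close> and hence at most \<open>rbar\<close>.\<close>

lemma q_in_Omega_p: "q \<in> Omega_p rbar dlo"
proof (rule Omega_pI[OF q_nonneg])
  have "0 \<le> expectation (\<lambda>z. max (fst z - snd z \<bullet> q) 0)" by (rule Bochner_Integration.integral_nonneg) auto
  then have "d \<bullet> q \<le> pop_dual d P q" by (simp add: pop_dual_def)
  also have "\<dots> \<le> pop_dual d P 0" by (rule pop_dual_min) simp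
  also have "\<dots> = expectation (\<lambda>z. max (fst z - snd z \<bullet> 0) 0)" unfolding pop_dual_def by simp
  also have "\<dots> \<le> expectation (\<lambda>_. rbar)"
    using columns_bounded rbar
    by (intro integral_mono_AE loss_integrable) (auto elim!: eventually_mono)
  also have "\<dots> = rbar" by simp
  finally show "d \<bullet> q \<le> rbar" .
qed

section \<open>Second moments and crossing of the acceptance threshold\<close>

lemma second_moment_quadratic_form:
  "x \<bullet> (second_moment P *v x) = expectation (\<lambda>z. (snd z \<bullet> x)\<^sup>2)"
proof -
  have int: "integrable P (\<lambda>z. snd z $ i * snd z $ j)" for i j
  proof (rule integrable_const_bound[of _ "abar * abar"])
    show "AE z in P. norm (snd z $ i * snd z $ j) \<le> abar * abar"
      using columns_bounded
    proof eventually_elim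
      case (elim z)
      then have "\<bar>snd z $ i\<bar> \<le> abar" "\<bar>snd z $ j\<bar> \<le> abar"
        using component_le_norm_cart[of "snd z" i] component_le_norm_cart[of "snd z" j] by auto
      then have "\<bar>snd z $ i\<bar> * \<bar>snd z $ j\<bar> \<le> abar * abar" by (intro mult_mono) auto
      then show ?case by (simp add: abs_mult)
    qed
  qed measurable
  have "expectation (\<lambda>z. (snd z \<bullet> x)\<^sup>2)
      = expectation (\<lambda>z. \<Sum>i\<in>UNIV. \<Sum>j\<in>UNIV. x $ i * (x $ j * (snd z $ i * snd z $ j)))"
    by (simp add: power2_eq_square inner_vec_def sum_product mult_ac)
  also have "\<dots> = (\<Sum>i\<in>UNIV. \<Sum>j\<in>UNIV. x $ i * (x $ j * expectation (\<lambda>z. snd z $ i * snd z $ j)))"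
    using int by simp
  also have "\<dots> = x \<bullet> (second_moment P *v x)"
    by (simp add: inner_vec_def matrix_vector_mult_def second_moment_def sum_distrib_left mult_ac)
  finally show ?thesis by simp
qed

lemma second_moment_lower: "lmin * (norm D)\<^sup>2 \<le> expectation (\<lambda>z. (snd z \<bullet> D)\<^sup>2)"
  using P_in_Xi min_eigval_le_quadratic_form[of "second_moment P" lmin D]
  by (simp add: Xi_def pos_definite_def second_moment_quadratic_form power2_norm_eq_inner)

lemma second_moment_upper: "expectation (\<lambda>z. (snd z \<bullet> D)\<^sup>2) \<le> (abar * norm D)\<^sup>2"
proof -
  have "expectation (\<lambda>z. (snd z \<bullet> D)\<^sup>2) \<le> expectation (\<lambda>_. (abar * norm D)\<^sup>2)"
  proof (rule integral_mono_AE[OF inner_square_integrable])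
    show "AE z in P. (snd z \<bullet> D)\<^sup>2 \<le> (abar * norm D)\<^sup>2"
      using inner_bounded[of D]
    proof eventually_elim
      case (elim z)
      then have "\<bar>snd z \<bullet> D\<bar>\<^sup>2 \<le> (abar * norm D)\<^sup>2" by (intro power_mono) auto
      then show ?case by simp
    qed
  qed simp
  then show ?thesis by simp
qed

text \<open>The sign of \<open>accept p - accept q\<close> is determined by \<open>a\<close> alone, so the absolute value in the
  assumption on the conditional probabilities can be taken inside the conditional expectation.\<close>

lemma crossing_expectation:
  assumes p: "q + D \<in> Omega_p rbar dlo"
  defines "W \<equiv> (\<lambda>z. - (snd z \<bullet> D) * (accept (q + D) z - accept q z))"
  shows "integrable P W" "lam * expectation (\<lambda>z. (snd z \<bullet> D)\<^sup>2) \<le> expectation W"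
    "expectation W \<le> mu * expectation (\<lambda>z. (snd z \<bullet> D)\<^sup>2)"
proof -
  define F where "F = vimage_algebra (space P) (snd :: real \<times> (real ^ 'm) \<Rightarrow> real ^ 'm) borel"
  interpret F: finite_measure_subalgebra P F
  proof
    show "subalgebra P F"
      unfolding subalgebra_def F_def
      by (auto simp: sets_vimage_algebra2 sets_P intro!: measurable_sets_borel[OF snd_measurable])
  qed
  have sndF: "snd \<in> F \<rightarrow>\<^sub>M (borel :: (real ^ 'm) measure)"
    unfolding F_def by (rule measurable_vimage_algebra1) simp
  define f where "f = (\<lambda>z :: real \<times> (real ^ 'm). - (snd z \<bullet> D))"
  have fF: "f \<in> borel_measurable F" unfolding f_def using sndF by measurable
  define g where "g = (\<lambda>z. accept (q + D) z - accept q z)"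
  have gm [measurable]: "g \<in> borel_measurable P" unfolding g_def by measurable
  have W: "W = (\<lambda>z. f z * g z)" by (simp add: W_def f_def g_def)
  show Wint: "integrable P W"
    using Bochner_Integration.integrable_diff[OF inner_accept_integrable[of D q]
        inner_accept_integrable[of D "q + D"]]
    by (simp add: W_def algebra_simps)
  then have fg: "integrable P (\<lambda>z. f z * g z)" by (simp add: W)
  have Wnn: "0 \<le> W z" for z
    using minus_mult_indicator_diff_nonneg[of "snd z \<bullet> D" "fst z - snd z \<bullet> q"]
    by (simp add: W_def accept_def indicator_def inner_add_right algebra_simps)
  define G where "G = real_cond_exp P F g"
  have EW: "integrable P (\<lambda>z. f z * G z)" "expectation W = expectation (\<lambda>z. f z * G z)"
    using F.real_cond_exp_intg[OF fg fF gm] by (simp_all add: W G_def)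
  have G: "AE z in P. G z = cond_prob_accept P (q + D) z - cond_prob_accept P q z"
    using F.real_cond_exp_diff[OF accept_integrable[of "q + D"] accept_integrable[of q]]
    by (simp add: G_def g_def cond_prob_accept_def accept_def F_def)
  \<comment> \<open>\<open>f * G\<close> is a version of the conditional expectation of the
    pointwise nonnegative \<open>W\<close>. Hence it equals the product of the absolute values, to
    which the two-sided bound applies.\<close>
  have nn: "AE z in P. 0 \<le> f z * G z"
  proof -
    have "AE z in P. 0 \<le> real_cond_exp P F (\<lambda>z. f z * g z) z"
      using Wnn borel_measurable_integrable[OF fg]
      by (intro F.real_cond_exp_pos) (simp_all add: W)
    moreover have "AE z in P. real_cond_exp P F (\<lambda>z. f z * g z) z = f z * G z"
      unfolding G_def by (rule F.real_cond_exp_mult[OF fF gm fg])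
    ultimately show ?thesis by eventually_elim simp
  qed
  have bounds: "AE z in P. lam * \<bar>f z\<bar> \<le> \<bar>G z\<bar> \<and> \<bar>G z\<bar> \<le> mu * \<bar>f z\<bar>"
  proof -
    have "cond_prob_bounds rbar dlo dhi lam mu P" using P_in_Xi by (simp add: Xi_def)
    then have "AE z in P. lam * \<bar>snd z \<bullet> (q + D) - snd z \<bullet> q\<bar>
        \<le> \<bar>cond_prob_accept P (q + D) z - cond_prob_accept P q z\<bar> \<and>
        \<bar>cond_prob_accept P (q + D) z - cond_prob_accept P q z\<bar>
        \<le> mu * \<bar>snd z \<bullet> (q + D) - snd z \<bullet> q\<bar>"
      using d q_opt p unfolding cond_prob_bounds_def by blast
    with G show ?thesis
      by eventually_elim (simp add: f_def inner_add_right)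
  qed
  have "AE z in P. lam * (snd z \<bullet> D)\<^sup>2 \<le> f z * G z \<and> f z * G z \<le> mu * (snd z \<bullet> D)\<^sup>2"
    using nn bounds
  proof eventually_elim
    case (elim z)
    have eq: "f z * G z = \<bar>f z\<bar> * \<bar>G z\<bar>" using elim by (simp flip: abs_mult)
    have "\<bar>f z\<bar> * (lam * \<bar>f z\<bar>) \<le> \<bar>f z\<bar> * \<bar>G z\<bar>" "\<bar>f z\<bar> * \<bar>G z\<bar> \<le> \<bar>f z\<bar> * (mu * \<bar>f z\<bar>)"
      using elim by (auto intro!: mult_left_mono)
    moreover have "\<bar>f z\<bar> * (c * \<bar>f z\<bar>) = c * (snd z \<bullet> D)\<^sup>2" for c
      by (simp add: f_def power2_eq_square abs_mult[symmetric] mult.left_commute)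
    ultimately show ?case unfolding eq by simp
  qed
  then have ae: "AE z in P. lam * (snd z \<bullet> D)\<^sup>2 \<le> f z * G z" "AE z in P. f z * G z \<le> mu * (snd z \<bullet> D)\<^sup>2"
    by (auto elim: eventually_mono)
  have "expectation (\<lambda>z. lam * (snd z \<bullet> D)\<^sup>2) \<le> expectation (\<lambda>z. f z * G z)"
    by (rule integral_mono_AE[OF _ EW(1) ae(1)]) (simp add: inner_square_integrable)
  then show "lam * expectation (\<lambda>z. (snd z \<bullet> D)\<^sup>2) \<le> expectation W" by (simp add: EW(2))
  have "expectation (\<lambda>z. f z * G z) \<le> expectation (\<lambda>z. mu * (snd z \<bullet> D)\<^sup>2)"
    by (rule integral_mono_AE[OF EW(1) _ ae(2)]) (simp add: inner_square_integrable)
  then show "expectation W \<le> mu * expectation (\<lambda>z. (snd z \<bullet> D)\<^sup>2)" by (simp add: EW(2))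
qed

section \<open>Mean of the linearization remainder\<close>

definition remainder :: "real ^ 'm \<Rightarrow> real \<times> (real ^ 'm) \<Rightarrow> real" where
  "remainder D z = kink (fst z - snd z \<bullet> q) (snd z \<bullet> D)"

lemma remainder_eq:
  "remainder D z = max (fst z - snd z \<bullet> (q + D)) 0 - max (fst z - snd z \<bullet> q) 0
    + (snd z \<bullet> D) * accept q z"
  by (simp add: remainder_def kink_def accept_def indicator_def inner_add_right algebra_simps)

lemma remainder_measurable [measurable]: "remainder D \<in> borel_measurable borel"
  unfolding remainder_eq by measurable

lemma remainder_integrable: "integrable P (remainder D)"
  unfolding remainder_eq by (intro Bochner_Integration.integrable_add
      Bochner_Integration.integrable_diff loss_integrable inner_accept_integrable)

text \<open>The divisor 4 comes from evaluating the second moment at \<open>D / 2\<close>.\<close>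

definition growth :: real where "growth = lam * lmin / 4"

lemma growth_pos: "0 < growth"
  using lam lmin by (simp add: growth_def)

text \<open>\<open>kink_lower\<close> reduces the remainder to a crossing between \<open>q\<close>
  and \<open>q + D / 2\<close>. That midpoint is in \<open>Omega_p\<close> by convexity, so the
  lower conditional probability bound and the least eigenvalue apply to it.\<close>

lemma remainder_expectation_lower:
  assumes "q + D \<in> Omega_p rbar dlo"
  shows "growth * (norm D)\<^sup>2 \<le> expectation (remainder D)"
proof -
  have h: "q + (1 / 2) *\<^sub>R D \<in> Omega_p rbar dlo"
    using Omega_p_segment[OF q_in_Omega_p assms, of "1 / 2"] by simp
  have "growth * (norm D)\<^sup>2 = lam * (lmin * (norm ((1 / 2) *\<^sub>R D))\<^sup>2)"
    by (simp add: growth_def power2_eq_square)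
  also have "\<dots> \<le> lam * expectation (\<lambda>z. (snd z \<bullet> ((1 / 2) *\<^sub>R D))\<^sup>2)"
    using lam by (intro mult_left_mono second_moment_lower) auto
  also have "\<dots> \<le> expectation (\<lambda>z. - (snd z \<bullet> ((1 / 2) *\<^sub>R D)) * (accept (q + (1 / 2) *\<^sub>R D) z - accept q z))"
    by (rule crossing_expectation(2)[OF h])
  also have "\<dots> \<le> expectation (remainder D)"
  proof (rule integral_mono[OF crossing_expectation(1)[OF h] remainder_integrable])
    fix z
    show "- (snd z \<bullet> ((1 / 2) *\<^sub>R D)) * (accept (q + (1 / 2) *\<^sub>R D) z - accept q z) \<le> remainder D z"
      using kink_lower[of "snd z \<bullet> D" "fst z - snd z \<bullet> q"]
      by (simp add: remainder_def accept_def indicator_def inner_add_right algebra_simps)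
  qed
  finally show ?thesis .
qed

text \<open>The quadratic order of the remainder yields the first-order optimality condition at
  \<open>q\<close> without differentiating under the integral.\<close>

lemma remainder_expectation_upper:
  assumes "q + D \<in> Omega_p rbar dlo"
  shows "expectation (remainder D) \<le> mu * (abar * norm D)\<^sup>2"
proof -
  have "expectation (remainder D) \<le> expectation (\<lambda>z. - (snd z \<bullet> D) * (accept (q + D) z - accept q z))"
  proof (rule integral_mono[OF remainder_integrable crossing_expectation(1)[OF assms]])
    fix z
    show "remainder D z \<le> - (snd z \<bullet> D) * (accept (q + D) z - accept q z)"
      using kink_upper[of "fst z - snd z \<bullet> q" "snd z \<bullet> D"]
      by (simp add: remainder_def accept_def indicator_def inner_add_right algebra_simps)
  qed
  also have "\<dots> \<le> mu * expectation (\<lambda>z. (snd z \<bullet> D)\<^sup>2)"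
    by (rule crossing_expectation(3)[OF assms])
  also have "\<dots> \<le> mu * (abar * norm D)\<^sup>2"
    using mu by (intro mult_left_mono second_moment_upper) auto
  finally show ?thesis .
qed

section \<open>First-order optimality of the population minimizer\<close>

definition grad :: "real ^ 'm" where
  "grad = d - (\<chi> i. expectation (\<lambda>z. snd z $ i * accept q z))"

lemma component_accept_integrable: "integrable P (\<lambda>z. snd z $ i * accept q z)"
  using inner_accept_integrable[of "axis i 1" q] by (simp add: inner_axis)

lemma grad_inner: "grad \<bullet> D = d \<bullet> D - expectation (\<lambda>z. (snd z \<bullet> D) * accept q z)"
proof -
  have "(\<chi> i. expectation (\<lambda>z. snd z $ i * accept q z)) \<bullet> D
      = (\<Sum>i\<in>UNIV. expectation (\<lambda>z. (snd z $ i * accept q z) * D $ i))"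
    by (simp add: inner_vec_def)
  also have "\<dots> = expectation (\<lambda>z. \<Sum>i\<in>UNIV. (snd z $ i * accept q z) * D $ i)"
    using component_accept_integrable by (intro Bochner_Integration.integral_sum[symmetric]) auto
  also have "\<dots> = expectation (\<lambda>z. (snd z \<bullet> D) * accept q z)"
    by (intro Bochner_Integration.integral_cong) (auto simp: inner_vec_def sum_distrib_right sum_distrib_left mult_ac)
  finally show ?thesis by (simp add: grad_def inner_diff_left)
qed

lemma pop_dual_expansion: "pop_dual d P (q + D) = pop_dual d P q + grad \<bullet> D + expectation (remainder D)"
proof -
  have "expectation (remainder D) = expectation (\<lambda>z. max (fst z - snd z \<bullet> (q + D)) 0)
      - expectation (\<lambda>z. max (fst z - snd z \<bullet> q) 0) + expectation (\<lambda>z. (snd z \<bullet> D) * accept q z)"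
    unfolding remainder_eq using loss_integrable[of "q + D"] loss_integrable[of q]
      inner_accept_integrable[of D q]
    by (subst Bochner_Integration.integral_add Bochner_Integration.integral_diff; simp)+
  then show ?thesis by (simp add: pop_dual_def grad_inner inner_add_right)
qed

text \<open>If the slope toward a feasible point were negative, a short step along the segment would
  lower the objective, since the linear term in \<open>t\<close> beats the remainder
  \<open>t\<^sup>2 * K\<close>.\<close>

lemma grad_inner_nonneg:
  assumes "q + D \<in> Omega_p rbar dlo"
  shows "0 \<le> grad \<bullet> D"
proof (rule ccontr)
  assume "\<not> 0 \<le> grad \<bullet> D"
  then have neg: "grad \<bullet> D < 0" by simp
  define K where "K = mu * (abar * norm D)\<^sup>2"
  have K: "0 \<le> K" using mu by (simp add: K_def)
  \<comment> \<open>The cap 1 keeps the step on the segment; the other entry makes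
    \<open>t * K\<close> at most half of the absolute slope. \<open>K + 1\<close> covers the case
    \<open>K = 0\<close>.\<close>
  define t where "t = min 1 (- (grad \<bullet> D) / (2 * (K + 1)))"
  have t: "0 < t" "t \<le> 1" using neg K by (auto simp: t_def divide_neg_pos)
  have in': "q + t *\<^sub>R D \<in> Omega_p rbar dlo"
    using Omega_p_segment[OF q_in_Omega_p assms, of t] t by simp
  then have "pop_dual d P q \<le> pop_dual d P (q + t *\<^sub>R D)"
    by (intro pop_dual_min) (simp add: Omega_p_def)
  also have "\<dots> \<le> pop_dual d P q + t * (grad \<bullet> D) + mu * (abar * norm (t *\<^sub>R D))\<^sup>2"
    unfolding pop_dual_expansion using remainder_expectation_upper[OF in'] by simp
  also have "mu * (abar * norm (t *\<^sub>R D))\<^sup>2 = t * (t * K)"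
    using t by (simp add: K_def power_mult_distrib power2_eq_square)
  finally have "0 \<le> t * (grad \<bullet> D + t * K)" by (simp add: algebra_simps)
  then have "0 \<le> grad \<bullet> D + t * K" using t by (simp add: zero_le_mult_iff)
  moreover have "t * K \<le> - (grad \<bullet> D) / (2 * (K + 1)) * (K + 1)"
    using K t neg by (intro mult_mono) (auto simp: t_def)
  moreover have "- (grad \<bullet> D) / (2 * (K + 1)) * (K + 1) = - (grad \<bullet> D) / 2"
    using K by (simp add: divide_simps)
  ultimately show False using neg by simp
qed

end

section \<open>The sample dual\<close>

text \<open>The net has radius \<open>mesh / n\<close>. The entry 1/2 keeps the norm of a net point
  at least half that of the point it approximates; the other entry makes the Lipschitz error at most
  \<open>g * (norm x)\<^sup>2 / 32\<close>.\<close>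

definition mesh :: "real \<Rightarrow> real \<Rightarrow> real" where
  "mesh abar g = min (1 / 2) (g / (64 * abar))"

text \<open>The first factor bounds the net size divided by \<open>n ^ m\<close>. The second is the
  constant of \<open>power_exp_sqrt_le\<close> for \<open>k = m\<close> and the decay rate
  \<open>g / (4 * abar)\<close>.\<close>

definition net_const :: "real \<Rightarrow> real \<Rightarrow> real \<Rightarrow> nat \<Rightarrow> real" where
  "net_const abar R g m = (2 * R * real m / mesh abar g + 2) ^ m
    * (fact (2 * (m + 1)) / (g / (4 * abar)) ^ (2 * (m + 1)))"

text \<open>The summands account for displacements shorter than \<open>1 / sqrt n\<close>, for the
  fluctuation of the gradient, and for the exceptional event, on which the error is only bounded by
  \<open>m * R\<close>.\<close>

definition rate_const :: "real \<Rightarrow> real \<Rightarrow> real \<Rightarrow> nat \<Rightarrow> real" where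
  "rate_const abar R g m = 1 + (32 / g)\<^sup>2 * (4 * real m * abar\<^sup>2)
    + (real m * R)\<^sup>2 * net_const abar R g m"

locale dual_sample = dual_problem P rbar abar dlo dhi lmin lam mu d q
  for P :: "(real \<times> (real ^ 'm::finite)) measure"
    and rbar abar dlo dhi lmin lam mu :: real and d q :: "real ^ 'm" +
  fixes M :: "'w measure" and X :: "nat \<Rightarrow> 'w \<Rightarrow> real \<times> (real ^ 'm)" and n :: nat
  assumes iid: "iid_sample n M X P" and n_pos: "0 < n"
begin

sublocale M: prob_space M
  using iid by (simp add: iid_sample_def)

section \<open>Sample gradient and sample remainder\<close>

lemma X_indep: "M.indep_vars (\<lambda>_. borel) X {1..n}"
  using iid by (simp add: iid_sample_def)

lemma X_measurable [measurable]: "j \<in> {1..n} \<Longrightarrow> X j \<in> borel_measurable M"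
  using X_indep by (auto simp: M.indep_vars_def)

lemma X_distr: "j \<in> {1..n} \<Longrightarrow> distr M borel (X j) = P"
  using iid by (simp add: iid_sample_def)

lemma expectation_X:
  fixes h :: "real \<times> (real ^ 'm) \<Rightarrow> real"
  assumes "j \<in> {1..n}" "h \<in> borel_measurable borel"
  shows "M.expectation (\<lambda>w. h (X j w)) = expectation h"
  using integral_distr[OF X_measurable[OF assms(1)] assms(2)] by (simp add: X_distr[OF assms(1)])

lemma AE_X:
  assumes "j \<in> {1..n}" "AE z in P. Q z"
  shows "AE w in M. Q (X j w)"
  using AE_distrD[OF X_measurable[OF assms(1)], of Q] assms(2) unfolding X_distr[OF assms(1)] .

lemma sample_bounded:
  "AE w in M. \<forall>j\<in>{1..n}. \<bar>fst (X j w)\<bar> \<le> rbar \<and> norm (snd (X j w)) \<le> abar"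
  by (intro AE_finite_allI AE_X[OF _ columns_bounded]) auto

definition sample_grad :: "'w \<Rightarrow> real ^ 'm" where
  "sample_grad w = d - (1 / real n) *\<^sub>R (\<Sum>j=1..n. accept q (X j w) *\<^sub>R snd (X j w))"

definition sample_remainder :: "real ^ 'm \<Rightarrow> 'w \<Rightarrow> real" where
  "sample_remainder D w = (1 / real n) * (\<Sum>j=1..n. remainder D (X j w))"

lemma sample_dual_expansion:
  "sample_dual n d (\<lambda>j. X j w) (q + D)
    = sample_dual n d (\<lambda>j. X j w) q + sample_grad w \<bullet> D + sample_remainder D w"
proof -
  have "sample_remainder D w = (1 / real n) * (\<Sum>j=1..n. max (fst (X j w) - snd (X j w) \<bullet> (q + D)) 0)
      - (1 / real n) * (\<Sum>j=1..n. max (fst (X j w) - snd (X j w) \<bullet> q) 0)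
      + (1 / real n) * (\<Sum>j=1..n. (snd (X j w) \<bullet> D) * accept q (X j w))"
    unfolding sample_remainder_def remainder_eq sum.distrib sum_subtractf
    by (simp add: algebra_simps)
  moreover have "sample_grad w \<bullet> D
      = d \<bullet> D - (1 / real n) * (\<Sum>j=1..n. (snd (X j w) \<bullet> D) * accept q (X j w))"
    by (simp add: sample_grad_def inner_diff_left inner_sum_left mult.commute)
  ultimately show ?thesis
    by (simp add: sample_dual_def inner_add_right)
qed

text \<open>Each coordinate of the difference is an average of independent centered terms bounded by
  \<open>2 * abar\<close>, so its second moment is at most \<open>4 * abar\<^sup>2 / n\<close>; the
  coordinates are then summed.\<close>

lemma sample_grad_second_moment:
  "integrable M (\<lambda>w. (norm (sample_grad w - grad))\<^sup>2)"
  "M.expectation (\<lambda>w. (norm (sample_grad w - grad))\<^sup>2) \<le> 4 * real CARD('m) * abar\<^sup>2 / real n"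
proof -
  define c where "c i = expectation (\<lambda>z. snd z $ i * accept q z)" for i :: 'm
  define h where "h i z = snd z $ i * accept q z - c i" for i and z :: "real \<times> (real ^ 'm)"
  have hm [measurable]: "h i \<in> borel_measurable borel" for i
    unfolding h_def by measurable
  have bd: "AE z in P. \<bar>snd z $ i * accept q z\<bar> \<le> abar" for i
    using columns_bounded
  proof eventually_elim
    case (elim z)
    have "\<bar>snd z $ i * accept q z\<bar> \<le> \<bar>snd z $ i\<bar> * 1"
      unfolding abs_mult using accept_range[of q z] by (intro mult_left_mono) auto
    also have "\<dots> \<le> abar" using component_le_norm_cart[of "snd z" i] elim by simp
    finally show ?case .
  qed
  have cb: "\<bar>c i\<bar> \<le> abar" for i
  proof -
    have "\<bar>c i\<bar> \<le> expectation (\<lambda>z. \<bar>snd z $ i * accept q z\<bar>)"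
      unfolding c_def by (rule integral_abs_bound)
    also have "\<dots> \<le> expectation (\<lambda>_. abar)"
      using bd component_accept_integrable by (intro integral_mono_AE) auto
    finally show ?thesis by simp
  qed
  have hb: "AE z in P. \<bar>h i z\<bar> \<le> 2 * abar" for i
    using bd[of i] by eventually_elim (use cb[of i] in \<open>auto simp: h_def\<close>)
  have Eh: "expectation (h i) = 0" for i
    unfolding h_def using component_accept_integrable by (simp add: c_def)
  have S: "integrable M (\<lambda>w. (\<Sum>j\<in>{1..n}. h i (X j w))\<^sup>2) \<and>
      M.expectation (\<lambda>w. (\<Sum>j\<in>{1..n}. h i (X j w))\<^sup>2) \<le> real (card {1..n}) * (2 * abar)\<^sup>2" for i
  proof (rule M.second_moment_centered_sum)
    show "M.indep_vars (\<lambda>_. borel) (\<lambda>j w. h i (X j w)) {1..n}"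
      by (rule M.indep_vars_compose2[OF X_indep]) simp
    show "AE w in M. \<bar>h i (X j w)\<bar> \<le> 2 * abar" if "j \<in> {1..n}" for j
      by (rule AE_X[OF that hb])
    show "M.expectation (\<lambda>w. h i (X j w)) = 0" if "j \<in> {1..n}" for j
      using expectation_X[OF that hm] by (simp add: Eh)
  qed simp
  have comp: "(sample_grad w - grad) $ i = - ((1 / real n) * (\<Sum>j\<in>{1..n}. h i (X j w)))" for w i
  proof -
    have "grad $ i = d $ i - c i" by (simp add: grad_def c_def)
    moreover have "sample_grad w $ i = d $ i - (1 / real n) * (\<Sum>j=1..n. snd (X j w) $ i * accept q (X j w))"
      by (simp add: sample_grad_def mult.commute)
    moreover have "(1 / real n) * (\<Sum>j=1..n. h i (X j w))
        = (1 / real n) * (\<Sum>j=1..n. snd (X j w) $ i * accept q (X j w)) - c i"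
      using n_pos by (simp add: h_def sum_subtractf diff_divide_distrib)
    ultimately show ?thesis by simp
  qed
  have eq: "(norm (sample_grad w - grad))\<^sup>2 = (\<Sum>i\<in>UNIV. (1 / real n)\<^sup>2 * (\<Sum>j\<in>{1..n}. h i (X j w))\<^sup>2)" for w
    unfolding power2_norm_eq_inner inner_vec_def inner_real_def comp
    by (simp add: power2_eq_square mult_ac)
  show "integrable M (\<lambda>w. (norm (sample_grad w - grad))\<^sup>2)"
    unfolding eq using S by auto
  have "M.expectation (\<lambda>w. (norm (sample_grad w - grad))\<^sup>2)
      = (\<Sum>i\<in>UNIV. (1 / real n)\<^sup>2 * M.expectation (\<lambda>w. (\<Sum>j\<in>{1..n}. h i (X j w))\<^sup>2))"
    unfolding eq using S by (subst Bochner_Integration.integral_sum) auto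
  also have "\<dots> \<le> (\<Sum>i\<in>(UNIV :: 'm set). (1 / real n)\<^sup>2 * (real n * (2 * abar)\<^sup>2))"
    using S by (intro sum_mono mult_left_mono) auto
  also have "\<dots> = 4 * real CARD('m) * abar\<^sup>2 / real n"
    using n_pos by (simp add: power2_eq_square field_simps)
  finally show "M.expectation (\<lambda>w. (norm (sample_grad w - grad))\<^sup>2) \<le> 4 * real CARD('m) * abar\<^sup>2 / real n" .
qed

lemma sample_remainder_measurable [measurable]: "sample_remainder D \<in> borel_measurable M"
  unfolding sample_remainder_def by measurable

text \<open>The terms have mean at least \<open>growth * (norm D)\<^sup>2\<close> but are at most
  \<open>abar * norm D\<close>. In the ratio one factor \<open>norm D\<close> cancels, so the
  exponent is linear in \<open>norm D\<close>.\<close>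

lemma sample_remainder_tail:
  assumes D: "q + D \<in> Omega_p rbar dlo" "D \<noteq> 0"
  shows "M.prob {w \<in> space M. sample_remainder D w \<le> growth * (norm D)\<^sup>2 / 4}
    \<le> exp (- (real n * growth * norm D / (4 * abar)))"
proof -
  have nD: "0 < norm D" using D by simp
  have "M.prob {w \<in> space M. (\<Sum>j\<in>{1..n}. remainder D (X j w)) \<le> real (card {1..n}) * (growth * (norm D)\<^sup>2) / 4}
      \<le> exp (- (real (card {1..n}) * (growth * (norm D)\<^sup>2) / (4 * (abar * norm D))))"
  proof (rule M.lower_tail_nonneg_sum)
    show "M.indep_vars (\<lambda>_. borel) (\<lambda>j w. remainder D (X j w)) {1..n}"
      by (rule M.indep_vars_compose2[OF X_indep]) simp
    show "0 < abar * norm D" using nD abar by simp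
    fix j assume j: "j \<in> {1..n}"
    show "growth * (norm D)\<^sup>2 \<le> M.expectation (\<lambda>w. remainder D (X j w))"
      using expectation_X[OF j remainder_measurable, of D] remainder_expectation_lower[OF D(1)] by simp
    have "AE z in P. 0 \<le> remainder D z \<and> remainder D z \<le> abar * norm D"
      using inner_bounded[of D]
    proof eventually_elim
      case (elim z)
      then show ?case
        using kink_bounds(1,2)[of "fst z - snd z \<bullet> q" "snd z \<bullet> D"] by (simp add: remainder_def)
    qed
    then show "AE w in M. 0 \<le> remainder D (X j w) \<and> remainder D (X j w) \<le> abar * norm D"
      by (rule AE_X[OF j])
  qed simp
  moreover have "sample_remainder D w \<le> growth * (norm D)\<^sup>2 / 4 \<longleftrightarrow>
      (\<Sum>j\<in>{1..n}. remainder D (X j w)) \<le> real (card {1..n}) * (growth * (norm D)\<^sup>2) / 4" for w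
    using n_pos by (simp add: sample_remainder_def field_simps)
  moreover have "real (card {1..n}) * (growth * (norm D)\<^sup>2) / (4 * (abar * norm D))
      = real n * growth * norm D / (4 * abar)"
    using nD abar by (simp add: power2_eq_square)
  ultimately show ?thesis by simp
qed

text \<open>This transfers the growth estimate from net points to all displacements, for every
  sample with bounded columns.\<close>

lemma sample_remainder_Lipschitz:
  assumes "\<forall>j\<in>{1..n}. norm (snd (X j w)) \<le> abar"
  shows "\<bar>sample_remainder D w - sample_remainder D' w\<bar> \<le> 2 * abar * norm (D - D')"
proof -
  have each: "\<bar>remainder D (X j w) - remainder D' (X j w)\<bar> \<le> 2 * abar * norm (D - D')"
    if j: "j \<in> {1..n}" for j
  proof -
    have "\<bar>remainder D (X j w) - remainder D' (X j w)\<bar> \<le> 2 * \<bar>snd (X j w) \<bullet> D - snd (X j w) \<bullet> D'\<bar>"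
      unfolding remainder_def by (rule kink_bounds)
    also have "\<dots> = 2 * \<bar>snd (X j w) \<bullet> (D - D')\<bar>" by (simp add: inner_diff_right)
    also have "\<dots> \<le> 2 * (norm (snd (X j w)) * norm (D - D'))"
      by (intro mult_left_mono Cauchy_Schwarz_ineq2) auto
    also have "\<dots> \<le> 2 * (abar * norm (D - D'))"
      using assms j by (intro mult_left_mono mult_right_mono) auto
    finally show ?thesis by simp
  qed
  have "\<bar>sample_remainder D w - sample_remainder D' w\<bar>
      = (1 / real n) * \<bar>\<Sum>j=1..n. remainder D (X j w) - remainder D' (X j w)\<bar>"
    by (simp add: sample_remainder_def sum_subtractf flip: diff_divide_distrib)
  also have "\<dots> \<le> (1 / real n) * (\<Sum>j=1..n. \<bar>remainder D (X j w) - remainder D' (X j w)\<bar>)"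
    by (intro mult_left_mono sum_abs) auto
  also have "\<dots> \<le> (1 / real n) * (\<Sum>j=1..n. 2 * abar * norm (D - D'))"
    using each by (intro mult_left_mono sum_mono) auto
  also have "\<dots> = 2 * abar * norm (D - D')" using n_pos by simp
  finally show ?thesis .
qed

text \<open>The comparison with the price vector 0, now for the sample objective.\<close>

lemma sample_opt_in_Omega_p:
  assumes opt: "sample_dual_opt n d (\<lambda>j. X j w) p"
    and bd: "\<forall>j\<in>{1..n}. \<bar>fst (X j w)\<bar> \<le> rbar"
  shows "p \<in> Omega_p rbar dlo"
proof (rule Omega_pI)
  have opt': "0 \<le> p $ i" "sample_dual n d (\<lambda>j. X j w) p \<le> sample_dual n d (\<lambda>j. X j w) 0" for i
    using opt by (auto simp: sample_dual_opt_def is_arg_min_linorder)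
  then show "0 \<le> p $ i" for i by simp
  have "d \<bullet> p \<le> sample_dual n d (\<lambda>j. X j w) p"
    unfolding sample_dual_def by (simp add: sum_nonneg)
  also have "\<dots> \<le> sample_dual n d (\<lambda>j. X j w) 0" by (rule opt')
  also have "\<dots> = (1 / real n) * (\<Sum>j=1..n. max (fst (X j w)) 0)" by (simp add: sample_dual_def)
  also have "\<dots> \<le> (1 / real n) * (\<Sum>j=1..n. rbar)"
    using bd rbar by (intro mult_left_mono sum_mono) (auto simp: abs_le_iff)
  also have "\<dots> = rbar" using n_pos by simp
  finally show "d \<bullet> p \<le> rbar" .
qed

section \<open>Uniform quadratic growth of the sample remainder\<close>

lemma mesh_pos: "0 < mesh abar growth"
  using growth_pos abar by (simp add: mesh_def)

text \<open>A grid of spacing of order \<open>1/n\<close> has only polynomially many points, which is negligible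
  against the failure probability \<open>exp (- c * sqrt n)\<close> of each single point.\<close>

lemma uniform_quadratic_growth:
  obtains bad where "bad \<in> sets M" "M.prob bad \<le> net_const abar (rbar / dlo) growth CARD('m) / real n"
    "\<And>w D. w \<in> space M - bad \<Longrightarrow> \<forall>j\<in>{1..n}. norm (snd (X j w)) \<le> abar \<Longrightarrow>
      q + D \<in> Omega_p rbar dlo \<Longrightarrow> 1 / sqrt (real n) \<le> norm D \<Longrightarrow>
      growth * (norm D)\<^sup>2 / 32 \<le> sample_remainder D w"
proof -
  define S where "S = {D. q + D \<in> Omega_p rbar dlo \<and> 1 / sqrt (real n) \<le> norm D}"
  define R where "R = rbar / dlo"
  have R: "0 \<le> R" using rbar dlo by (simp add: R_def)
  \<comment> \<open>Division by the dimension offsets the factor in \<open>grid_cover\<close>, which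
    leaves the covering radius \<open>mesh / n\<close>.\<close>
  define e where "e = mesh abar growth / real n / real CARD('m)"
  have e: "0 < e" using mesh_pos n_pos by (simp add: e_def)
  have S: "\<bar>D $ i\<bar> \<le> R" if "D \<in> S" for D i
    using Omega_p_diff_bounded(1)[of "q + D" q i] that q_in_Omega_p by (simp add: S_def R_def)
  obtain F where F: "finite F" "F \<subseteq> S" "real (card F) \<le> (2 * R / e + 2) ^ CARD('m)"
    and cover: "\<And>x. x \<in> S \<Longrightarrow> \<exists>y\<in>F. norm (x - y) \<le> real CARD('m) * e"
    using grid_cover[OF S e R] by blast
  define E where "E D = {w \<in> space M. sample_remainder D w \<le> growth * (norm D)\<^sup>2 / 4}" for D
  have Em: "E D \<in> sets M" for D unfolding E_def by measurable
  define bad where "bad = (\<Union>D\<in>F. E D)"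
  define c where "c = growth / (4 * abar)"
  have c: "0 < c" using growth_pos abar by (simp add: c_def)
  have EF: "M.prob (E D) \<le> exp (- (c * sqrt (real n)))" if "D \<in> F" for D
  proof -
    have D: "q + D \<in> Omega_p rbar dlo" "1 / sqrt (real n) \<le> norm D"
      using that F(2) by (auto simp: S_def)
    have "0 < 1 / sqrt (real n)" using n_pos by simp
    then have "D \<noteq> 0" using D(2) by auto
    then have "M.prob (E D) \<le> exp (- (real n * growth * norm D / (4 * abar)))"
      unfolding E_def by (rule sample_remainder_tail[OF D(1)])
    also have "real n * growth * norm D / (4 * abar) = c * (real n * norm D)"
      by (simp add: c_def)
    also have "exp (- (c * (real n * norm D))) \<le> exp (- (c * sqrt (real n)))"
    proof -
      have "sqrt (real n) = real n * (1 / sqrt (real n))" using n_pos by (simp add: real_div_sqrt)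
      also have "\<dots> \<le> real n * norm D" using D(2) by (intro mult_left_mono) auto
      finally show ?thesis using c by simp
    qed
    finally show ?thesis .
  qed
  show thesis
  proof
    show "bad \<in> sets M" unfolding bad_def using F(1) Em by auto
    have "M.prob bad \<le> (\<Sum>D\<in>F. M.prob (E D))"
      unfolding bad_def using F(1) Em by (intro M.finite_measure_subadditive_finite) auto
    also have "\<dots> \<le> real (card F) * exp (- (c * sqrt (real n)))"
      using EF by (intro sum_bounded_above)
    also have "\<dots> \<le> ((2 * R * real CARD('m) / mesh abar growth + 2) * real n) ^ CARD('m) * exp (- (c * sqrt (real n)))"
    \<comment> \<open>As \<open>n\<close> is at least 1, the summand 2 is at most
      \<open>2 * n\<close>, so a factor \<open>n\<close> can be pulled out of the base.\<close>
    proof (intro mult_right_mono order_trans[OF F(3)] power_mono)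
      have "2 * R / e = 2 * R * real CARD('m) / mesh abar growth * real n" by (simp add: e_def)
      moreover have "2 \<le> 2 * real n" using n_pos by simp
      ultimately show "2 * R / e + 2 \<le> (2 * R * real CARD('m) / mesh abar growth + 2) * real n"
        by (simp add: distrib_right)
      show "0 \<le> 2 * R / e + 2" using R e by (simp add: add_nonneg_nonneg)
    qed auto
    also have "\<dots> = (2 * R * real CARD('m) / mesh abar growth + 2) ^ CARD('m)
        * (real n ^ CARD('m) * exp (- (c * sqrt (real n))))"
      by (simp add: power_mult_distrib)
    also have "\<dots> \<le> (2 * R * real CARD('m) / mesh abar growth + 2) ^ CARD('m)
        * (fact (2 * (CARD('m) + 1)) / c ^ (2 * (CARD('m) + 1)) / real n)"
      using R mesh_pos by (intro mult_left_mono power_exp_sqrt_le c n_pos) auto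
    also have "\<dots> = net_const abar (rbar / dlo) growth CARD('m) / real n"
      by (simp add: net_const_def R_def c_def)
    finally show "M.prob bad \<le> net_const abar (rbar / dlo) growth CARD('m) / real n" .
    fix w x
    assume w: "w \<in> space M - bad" and bd: "\<forall>j\<in>{1..n}. norm (snd (X j w)) \<le> abar"
      and x: "q + x \<in> Omega_p rbar dlo" "1 / sqrt (real n) \<le> norm x"
    obtain y where y: "y \<in> F" "norm (x - y) \<le> real CARD('m) * e"
      using cover[of x] x by (auto simp: S_def)
    then have xy: "norm (x - y) \<le> mesh abar growth / real n" by (simp add: e_def)
    have nx: "0 < norm x" using x(2) n_pos
      by (meson less_le_trans of_nat_0_less_iff real_sqrt_gt_0_iff zero_less_divide_1_iff)
    \<comment> \<open>The covering error of order \<open>1 / n\<close> is therefore at most of the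
      order of the quadratic growth itself.\<close>
    have sq: "1 / real n \<le> (norm x)\<^sup>2"
      using power_mono[OF x(2), of 2] n_pos by (simp add: power_divide)
    have "norm y \<ge> norm x / 2"
    proof -
      have "mesh abar growth / real n \<le> (1 / 2) / real n" by (intro divide_right_mono) (auto simp: mesh_def)
      also have "\<dots> \<le> 1 / sqrt (real n) / 2"
      proof -
        have "1 / real n = (1 / sqrt (real n)) * (1 / sqrt (real n))" using n_pos by simp
        also have "\<dots> \<le> (1 / sqrt (real n)) * 1" using n_pos by (intro mult_left_mono) auto
        finally show ?thesis by simp
      qed
      also have "\<dots> \<le> norm x / 2" using x(2) by simp
      finally have "norm (x - y) \<le> norm x / 2" using xy by linarith
      then show ?thesis using norm_triangle_ineq2[of x y] by simp
    qed
    then have "(norm x / 2)\<^sup>2 \<le> (norm y)\<^sup>2" using nx by (intro power_mono) auto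
    then have "growth * (norm x / 2)\<^sup>2 \<le> growth * (norm y)\<^sup>2"
      using growth_pos by (intro mult_left_mono) auto
    moreover have "growth * (norm y)\<^sup>2 / 4 < sample_remainder y w"
      using w y(1) by (force simp: bad_def E_def)
    moreover have "sample_remainder y w \<le> sample_remainder x w + 2 * abar * (mesh abar growth / real n)"
    proof -
      have "2 * abar * norm (x - y) \<le> 2 * abar * (mesh abar growth / real n)"
        using xy abar by (intro mult_left_mono) auto
      then show ?thesis using sample_remainder_Lipschitz[OF bd, of x y] by linarith
    qed
    moreover have "2 * abar * (mesh abar growth / real n) \<le> growth * (norm x)\<^sup>2 / 32"
    proof -
      have "2 * abar * mesh abar growth \<le> 2 * abar * (growth / (64 * abar))"
        using abar by (intro mult_left_mono) (auto simp: mesh_def)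
      also have "\<dots> = growth / 32" using abar by simp
      finally have "2 * abar * mesh abar growth * (1 / real n) \<le> growth / 32 * (norm x)\<^sup>2"
        using sq growth_pos by (intro mult_mono) auto
      then show ?thesis by simp
    qed
    \<comment> \<open>The net point contributes at least 1/16 of
      \<open>growth * (norm x)\<^sup>2\<close>, a quarter from the tail threshold times a quarter
      from the halved norm. The Lipschitz error takes away at most 1/32.\<close>
    ultimately show "growth * (norm x)\<^sup>2 / 32 \<le> sample_remainder x w"
      by (simp add: power_divide)
  qed
qed

section \<open>Mean squared error of the sample optimum\<close>

text \<open>Almost surely the squared error is dominated by \<open>B\<close>, whose three summands
  cover short displacements, long displacements with uniform growth, and the exceptional event.
  Integrating \<open>B\<close> gives the rate.\<close>

lemma dual_convergence_rate:
  assumes pn [measurable]: "pn \<in> borel_measurable M"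
    and opt: "\<And>w. w \<in> space M \<Longrightarrow> sample_dual_opt n d (\<lambda>j. X j w) (pn w)"
  shows "integrable M (\<lambda>w. (norm (pn w - q))\<^sup>2)"
    "M.expectation (\<lambda>w. (norm (pn w - q))\<^sup>2) \<le> rate_const abar (rbar / dlo) growth CARD('m) / real n"
proof -
  define R where "R = real CARD('m) * (rbar / dlo)"
  obtain bad where bad [measurable]: "bad \<in> sets M" and prob_bad: "M.prob bad \<le> net_const abar (rbar / dlo) growth CARD('m) / real n"
    and good: "\<And>w D. w \<in> space M - bad \<Longrightarrow> \<forall>j\<in>{1..n}. norm (snd (X j w)) \<le> abar \<Longrightarrow>
      q + D \<in> Omega_p rbar dlo \<Longrightarrow> 1 / sqrt (real n) \<le> norm D \<Longrightarrow>
      growth * (norm D)\<^sup>2 / 32 \<le> sample_remainder D w"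
    using uniform_quadratic_growth by blast
  have inO: "AE w in M. pn w \<in> Omega_p rbar dlo"
    using sample_bounded AE_space
  proof eventually_elim
    case (elim w)
    then show ?case by (intro sample_opt_in_Omega_p[OF opt]) auto
  qed
  have le_R: "AE w in M. (norm (pn w - q))\<^sup>2 \<le> R\<^sup>2"
    using inO
  proof eventually_elim
    case (elim w)
    then show ?case unfolding R_def
      by (intro power_mono Omega_p_diff_bounded(2) q_in_Omega_p) auto
  qed
  show int: "integrable M (\<lambda>w. (norm (pn w - q))\<^sup>2)"
    using le_R by (intro M.integrable_const_bound[of _ "R\<^sup>2"]) auto
  define B where "B w = 1 / real n + (32 / growth)\<^sup>2 * (norm (sample_grad w - grad))\<^sup>2
    + R\<^sup>2 * indicator bad w" for w
  have "AE w in M. (norm (pn w - q))\<^sup>2 \<le> B w"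
    using sample_bounded inO le_R AE_space
  proof eventually_elim
    case (elim w)
    define D where "D = pn w - q"
    have qD: "q + D = pn w" by (simp add: D_def)
    have nn: "0 \<le> (32 / growth)\<^sup>2 * (norm (sample_grad w - grad))\<^sup>2" by simp
    consider "w \<in> bad" | "norm D < 1 / sqrt (real n)"
      | "w \<notin> bad" "1 / sqrt (real n) \<le> norm D" by fastforce
    then show ?case
    proof cases
      case 1
      then show ?thesis using elim nn by (simp add: B_def add_increasing)
    next
      case 2
      then have "(norm D)\<^sup>2 \<le> (1 / sqrt (real n))\<^sup>2" by (intro power_mono) auto
      then have "(norm D)\<^sup>2 \<le> 1 / real n" by (simp add: power_divide)
      moreover have "0 \<le> R\<^sup>2 * indicator bad w" by simp
      ultimately show ?thesis using nn unfolding B_def D_def by linarith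
    next
      case 3
      have in': "q + D \<in> Omega_p rbar dlo" using elim qD by simp
      have "growth * (norm D)\<^sup>2 / 32 \<le> sample_remainder D w"
        using 3 elim in' by (intro good) auto
      \<comment> \<open>Optimality of \<open>pn w\<close> for the sample, compared with the feasible
        point \<open>q\<close>, makes gradient term plus remainder nonpositive.\<close>
      also have "\<dots> \<le> - (sample_grad w \<bullet> D)"
      proof -
        have "sample_dual n d (\<lambda>j. X j w) (q + D) \<le> sample_dual n d (\<lambda>j. X j w) q"
          using opt[of w] elim q_nonneg by (auto simp: qD sample_dual_opt_def is_arg_min_linorder)
        then show ?thesis by (simp add: sample_dual_expansion)
      qed
      \<comment> \<open>Optimality of \<open>q\<close> for the population allows the nonnegative
        \<open>grad \<bullet> D\<close> to be added, so that only the centered fluctuation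
        remains.\<close>
      also have "\<dots> \<le> - ((sample_grad w - grad) \<bullet> D)"
        using grad_inner_nonneg[OF in'] by (simp add: inner_diff_left)
      also have "\<dots> \<le> norm (sample_grad w - grad) * norm D"
        using Cauchy_Schwarz_ineq2[of "sample_grad w - grad" D] by linarith
      finally have "growth * norm D / 32 * norm D \<le> norm (sample_grad w - grad) * norm D"
        by (simp add: power2_eq_square)
      moreover have "0 < norm D"
        using 3(2) n_pos by (meson less_le_trans of_nat_0_less_iff real_sqrt_gt_0_iff zero_less_divide_1_iff)
      ultimately have "growth * norm D / 32 \<le> norm (sample_grad w - grad)" by simp
      then have "norm D \<le> 32 / growth * norm (sample_grad w - grad)"
        using growth_pos by (simp add: field_simps)
      then have "(norm D)\<^sup>2 \<le> (32 / growth * norm (sample_grad w - grad))\<^sup>2"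
        by (intro power_mono) auto
      then have "(norm D)\<^sup>2 \<le> (32 / growth)\<^sup>2 * (norm (sample_grad w - grad))\<^sup>2"
        by (simp only: power_mult_distrib)
      moreover have "0 \<le> R\<^sup>2 * indicator bad w" "0 \<le> 1 / real n" by simp_all
      ultimately show ?thesis unfolding B_def D_def by linarith
    qed
  qed
  moreover have ints: "integrable M (\<lambda>w. (32 / growth)\<^sup>2 * (norm (sample_grad w - grad))\<^sup>2)"
    "integrable M (\<lambda>w. R\<^sup>2 * indicator bad w)"
    using sample_grad_second_moment(1)
    by (intro integrable_mult_right integrable_real_indicator; simp add: M.emeasure_eq_measure)+
  then have intB: "integrable M B"
    unfolding B_def by (intro Bochner_Integration.integrable_add) auto
  ultimately have "M.expectation (\<lambda>w. (norm (pn w - q))\<^sup>2) \<le> M.expectation B"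
    using int intB by (intro integral_mono_AE)
  also have "\<dots> = 1 / real n + (32 / growth)\<^sup>2 * M.expectation (\<lambda>w. (norm (sample_grad w - grad))\<^sup>2)
      + R\<^sup>2 * M.prob bad"
    unfolding B_def using ints
    by (subst Bochner_Integration.integral_add; simp add: M.prob_space)+
  also have "\<dots> \<le> 1 / real n + (32 / growth)\<^sup>2 * (4 * real CARD('m) * abar\<^sup>2 / real n)
      + R\<^sup>2 * (net_const abar (rbar / dlo) growth CARD('m) / real n)"
    using sample_grad_second_moment(2) prob_bad by (intro add_mono mult_left_mono) auto
  also have "\<dots> = rate_const abar (rbar / dlo) growth CARD('m) / real n"
    by (simp add: rate_const_def R_def add_divide_distrib)
  finally show "M.expectation (\<lambda>w. (norm (pn w - q))\<^sup>2) \<le> rate_const abar (rbar / dlo) growth CARD('m) / real n" .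
qed

end

section \<open>From the rate 1/n to the stated bound\<close>

text \<open>The dimension is at least 2 because for dimension 1 the factor
  \<open>ln (real CARD('m))\<close> would make the right-hand sides zero. The constant is built from
  the fixed parameters and the dimension before \<open>n\<close> and \<open>P\<close> are
  chosen.\<close>

theorem theorem1:
  fixes rbar abar dlo dhi lmin lam mu :: real
  assumes "0 < rbar" and "0 < abar" and "0 < dlo" and "dlo < dhi"
    and "0 < lmin" and "0 < lam" and "0 < mu"
    and "2 \<le> CARD('m::finite)"
  shows "\<exists>C::real. \<forall>(n::nat) (b::real ^ 'm) (P::(real \<times> (real ^ 'm)) measure)
      (M::'w measure) (X::nat \<Rightarrow> 'w \<Rightarrow> real \<times> (real ^ 'm)) (pn::'w \<Rightarrow> real ^ 'm) (pstar::real ^ 'm).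
      max CARD('m) 3 \<le> n \<longrightarrow>
      CARD('m) < n \<longrightarrow>
      (\<forall>i. 0 < b $ i) \<longrightarrow>
      avg_budget n b \<in> Omega_d dlo dhi \<longrightarrow>
      P \<in> Xi rbar abar dlo dhi lmin lam mu (avg_budget n b) \<longrightarrow>
      iid_sample n M X P \<longrightarrow>
      pn \<in> borel_measurable M \<longrightarrow>
      (\<forall>w\<in>space M. sample_dual_opt n (avg_budget n b) (\<lambda>j. X j w) (pn w)) \<longrightarrow>
      pop_dual_opt (avg_budget n b) P pstar \<longrightarrow>
      integrable M (\<lambda>w. (norm (pn w - pstar))\<^sup>2) \<and>
      integrable M (\<lambda>w. norm (pn w - pstar)) \<and>
      prob_space.expectation M (\<lambda>w. (norm (pn w - pstar))\<^sup>2)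
        \<le> C * real CARD('m) * ln (real CARD('m)) * ln (ln (real n)) / real n \<and>
      prob_space.expectation M (\<lambda>w. norm (pn w - pstar))
        \<le> sqrt (C * real CARD('m) * ln (real CARD('m)) * ln (ln (real n)) / real n)"
proof -
  define m where "m = real CARD('m)"
  \<comment> \<open>The absolute value makes \<open>C\<close> nonnegative, so that replacing
    \<open>ln (ln 3)\<close> by the larger \<open>ln (ln n)\<close> preserves the bound.\<close>
  define K where "K = \<bar>rate_const abar (rbar / dlo) (lam * lmin / 4) CARD('m)\<bar>"
  define C where "C = K / (m * ln m * ln (ln 3))"
  have m: "2 \<le> m" using assms(8) by (simp add: m_def)
  then have mlnm: "0 < m * ln m" by simp
  \<comment> \<open>Since \<open>exp 1\<close> is below 3, the iterated logarithm is positive from 3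
    onward, and \<open>C\<close> may divide by its value there.\<close>
  have "1 < ln (3 :: real)"
    using ln_less_cancel_iff[of "exp 1" "3 :: real"] e_less_272 by simp
  then have lnln3: "0 < ln (ln (3 :: real))" by simp
  show ?thesis
  proof (intro exI[of _ C] allI impI)
    fix n :: nat and b :: "real ^ 'm" and P :: "(real \<times> (real ^ 'm)) measure" and M :: "'w measure"
      and X :: "nat \<Rightarrow> 'w \<Rightarrow> real \<times> (real ^ 'm)" and pn :: "'w \<Rightarrow> real ^ 'm" and pstar :: "real ^ 'm"
    assume n: "max CARD('m) 3 \<le> n"
      and d: "avg_budget n b \<in> Omega_d dlo dhi"
      and P: "P \<in> Xi rbar abar dlo dhi lmin lam mu (avg_budget n b)"
      and X: "iid_sample n M X P"
      and pn: "pn \<in> borel_measurable M"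
      and opt: "\<forall>w\<in>space M. sample_dual_opt n (avg_budget n b) (\<lambda>j. X j w) (pn w)"
      and pstar: "pop_dual_opt (avg_budget n b) P pstar"
    interpret P: prob_space P using P by (simp add: Xi_def)
    interpret dual_sample P rbar abar dlo dhi lmin lam mu "avg_budget n b" pstar M X n
      using assms n d P X pstar by unfold_locales auto
    have int: "integrable M (\<lambda>w. (norm (pn w - pstar))\<^sup>2)"
      and rate: "M.expectation (\<lambda>w. (norm (pn w - pstar))\<^sup>2) \<le> K / real n"
    proof -
      show "integrable M (\<lambda>w. (norm (pn w - pstar))\<^sup>2)"
        using dual_convergence_rate(1)[OF pn] opt by blast
      have "M.expectation (\<lambda>w. (norm (pn w - pstar))\<^sup>2)
          \<le> rate_const abar (rbar / dlo) growth CARD('m) / real n"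
        using dual_convergence_rate(2)[OF pn] opt by blast
      also have "\<dots> \<le> K / real n" unfolding K_def growth_def by (intro divide_right_mono) auto
      finally show "M.expectation (\<lambda>w. (norm (pn w - pstar))\<^sup>2) \<le> K / real n" .
    qed
    have int1: "integrable M (\<lambda>w. norm (pn w - pstar))"
      using pn by (intro M.square_integrable_imp_integrable[OF _ int]) simp
    have lnln: "ln (ln 3) \<le> ln (ln (real n))"
      using n \<open>1 < ln 3\<close> by (subst ln_le_cancel_iff) (auto intro: less_le_trans)
    have "K = C * m * ln m * ln (ln 3)"
      using m lnln3 by (simp add: C_def)
    also have "\<dots> \<le> C * m * ln m * ln (ln (real n))"
      using lnln mlnm lnln3 m by (intro mult_left_mono) (auto simp: C_def K_def)
    finally have "K / real n \<le> C * m * ln m * ln (ln (real n)) / real n"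
      by (intro divide_right_mono) auto
    with rate have second: "M.expectation (\<lambda>w. (norm (pn w - pstar))\<^sup>2)
        \<le> C * m * ln m * ln (ln (real n)) / real n" by simp
    \<comment> \<open>Nonnegativity of the variance of the norm, which yields the bound on the first
      moment from that on the second.\<close>
    have "(M.expectation (\<lambda>w. norm (pn w - pstar)))\<^sup>2 \<le> M.expectation (\<lambda>w. (norm (pn w - pstar))\<^sup>2)"
      using M.variance_eq[OF int1 int] M.variance_positive[of "\<lambda>w. norm (pn w - pstar)"] by simp
    also note second
    finally have "M.expectation (\<lambda>w. norm (pn w - pstar))
        \<le> sqrt (C * m * ln m * ln (ln (real n)) / real n)"
      by (rule real_le_rsqrt)
    with int int1 second
    show "integrable M (\<lambda>w. (norm (pn w - pstar))\<^sup>2) \<and>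
      integrable M (\<lambda>w. norm (pn w - pstar)) \<and>
      prob_space.expectation M (\<lambda>w. (norm (pn w - pstar))\<^sup>2)
        \<le> C * real CARD('m) * ln (real CARD('m)) * ln (ln (real n)) / real n \<and>
      prob_space.expectation M (\<lambda>w. norm (pn w - pstar))
        \<le> sqrt (C * real CARD('m) * ln (real CARD('m)) * ln (ln (real n)) / real n)"
      unfolding m_def by blast
  qed
qed

end
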